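(* Let $\theta>0$ and let $(Z_{ij}: i,j\in\mathbb{Z})$ be a real stationary Gaussian process indexed by $\mathbb{Z}^2$ with mean $\theta$ and covariance kernel $R(i,j)=\mathrm{Cov}(Z_{00},Z_{ij})$, $i,j\in\mathbb{Z}$. Assume $$\sum_{i=-\infty}^{\infty}\sum_{j=-\infty}^{\infty}|R(i,j)|<\infty \quad\text{and}\quad \sum_{i=-\infty}^{\infty}\sum_{j=-\infty}^{\infty}R(i,j)\neq 0.$$ For $N\ge1$ let $A_N$ be the $N\times N$ symmetric random matrix with $A_N(i,j)=Z_{ij}+Z_{ji}$, $1\le i,j\le N$, and let $\lambda_1(A_N)$ be its largest eigenvalue. Then $$\lambda_1(A_N)-2N\theta \Rightarrow N(\alpha,\sigma^2),\qquad N\to\infty,$$ (convergence in distribution to a normal law), where $$\alpha=\frac{1}{2\theta}\sum_{i=-\infty}^{\infty}\big(R(i,0)+R(0,i)\big),\qquad \sigma^2=4\sum_{i=-\infty}^{\infty}\sum_{j=-\infty}^{\infty}R(i,j).$$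
   Context: Stationarity of the Gaussian process means that its law is invariant under shifts $(i,j)\mapsto(i+a,j+b)$ of the index set $\mathbb{Z}^2$, so $\mathrm{Cov}(Z_{ij},Z_{kl})=R(k-i,l-j)$. *)

theory Defs
  imports "HOL-Probability.Probability" "Jordan_Normal_Form.Char_Poly"
begin

definition covariance :: "'a measure \<Rightarrow> ('a \<Rightarrow> real) \<Rightarrow> ('a \<Rightarrow> real) \<Rightarrow> real" where
  "covariance M X Y =
     integral\<^sup>L M (\<lambda>\<omega>. (X \<omega> - integral\<^sup>L M X) * (Y \<omega> - integral\<^sup>L M Y))"

definition gaussian_rv :: "'a measure \<Rightarrow> ('a \<Rightarrow> real) \<Rightarrow> bool" where
  "gaussian_rv M X \<longleftrightarrow>
     X \<in> borel_measurable M \<and>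
     ((\<exists>c. AE \<omega> in M. X \<omega> = c) \<or>
      (\<exists>\<mu> \<sigma>. \<sigma> > 0 \<and> distributed M lborel X (normal_density \<mu> \<sigma>)))"

definition gaussian_process_Z2 :: "'a measure \<Rightarrow> (int \<Rightarrow> int \<Rightarrow> 'a \<Rightarrow> real) \<Rightarrow> bool" where
  "gaussian_process_Z2 M Z \<longleftrightarrow>
     (\<forall>S c. finite S \<longrightarrow> gaussian_rv M (\<lambda>\<omega>. \<Sum>p\<in>S. c p * Z (fst p) (snd p) \<omega>))"

definition process_law :: "'a measure \<Rightarrow> (int \<Rightarrow> int \<Rightarrow> 'a \<Rightarrow> real) \<Rightarrow> (int \<times> int \<Rightarrow> real) measure" where
  "process_law M Z = distr M (Pi\<^sub>M UNIV (\<lambda>_. borel)) (\<lambda>\<omega> p. Z (fst p) (snd p) \<omega>)"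

definition stationary_Z2 :: "'a measure \<Rightarrow> (int \<Rightarrow> int \<Rightarrow> 'a \<Rightarrow> real) \<Rightarrow> bool" where
  "stationary_Z2 M Z \<longleftrightarrow>
     (\<forall>a b. process_law M (\<lambda>i j. Z (i + a) (j + b)) = process_law M Z)"

definition largest_eigenvalue :: "real mat \<Rightarrow> real" where
  "largest_eigenvalue A = Max {l. eigenvalue A l}"

text \<open>The matrix \<open>A_N(i,j) = Z_ij + Z_ji\<close>, \<open>1 \<le> i,j \<le> N\<close> (0-based storage).\<close>
definition A_mat :: "(int \<Rightarrow> int \<Rightarrow> 'a \<Rightarrow> real) \<Rightarrow> nat \<Rightarrow> 'a \<Rightarrow> real mat" where
  "A_mat Z N \<omega> = mat N N (\<lambda>(i, j). Z (int i + 1) (int j + 1) \<omega> + Z (int j + 1) (int i + 1) \<omega>)"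

end

theory Submission
  imports Defs
begin

text \<open>
  Write \<open>A\<^sub>N = 2\<theta> 1 1\<^sup>T + W\<close> with the centred matrix \<open>W\<^sub>i\<^sub>j = (Z\<^sub>i\<^sub>j - \<theta>) + (Z\<^sub>j\<^sub>i - \<theta>)\<close>, and put
  \<open>m = 2\<theta>N\<close>, \<open>s = 1\<^sup>TW1 / N\<close>, \<open>p = |W1|\<^sup>2 / N - s\<^sup>2\<close>. If \<open>\<rho>\<close> bounds the operator norm of \<open>W\<close>, the variational
  characterisation of the largest eigenvalue gives
  \<open>m + s + p/m - (\<rho>p/m\<^sup>2 + |s|p/m\<^sup>2 + p\<^sup>2/m\<^sup>3) \<le> \<lambda> \<le> m + s + p/(m + s - \<rho>)\<close>.
  Wick's formula for four Gaussian factors and the summability of \<open>R\<close> show that the trace of \<open>W\<^sup>4\<close> has expectation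
  \<open>O(N\<^sup>3)\<close>, so \<open>\<rho> = o(N)\<close> in probability, and that \<open>|W1|\<^sup>2 / N\<^sup>2\<close> converges in mean square to
  \<open>\<kappa> = \<Sum>\<^sub>i (R(i,0) + R(0,i))\<close>. Hence \<open>\<lambda> - m = s + \<kappa>/(2\<theta>) + o(1)\<close> in probability, where \<open>s\<close> is exactly centred
  Gaussian with variance tending to \<open>4 \<Sum>\<^sub>i\<^sub>j R(i,j)\<close>.
\<close>

section \<open>The largest eigenvalue as a maximum of Rayleigh quotients\<close>

text \<open>The fourth power of W is what the scale demands: the trace of W^2 is of order N^2 and
  bounds the operator norm only by order N, the size of m itself, while the trace of W^4 gives o(N).
  This crude bound suffices because \<rho> enters only as a relative correction to p/m, and p/m is
  of order one: p is about \<kappa> N and m = 2 \<theta> N. That second-order term is the whole mean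
  shift; it arises because the all-ones vector is not an eigenvector of W. All matrix estimates are
  deterministic and controlled by a single \<delta>; probability enters them only through Markov
  bounds for three events.\<close>

definition quad_form :: "nat \<Rightarrow> (nat \<Rightarrow> nat \<Rightarrow> real) \<Rightarrow> (nat \<Rightarrow> real) \<Rightarrow> real" where
  "quad_form N a x = (\<Sum>i<N. \<Sum>j<N. a i j * x i * x j)"

lemma quad_form_scale: "quad_form N a (\<lambda>i. c * x i) = c\<^sup>2 * quad_form N a x"
  unfolding quad_form_def by (simp add: sum_distrib_left power2_eq_square mult_ac)

lemma quad_form_cong: "(\<And>i. i < N \<Longrightarrow> x i = y i) \<Longrightarrow> quad_form N a x = quad_form N a y"
  unfolding quad_form_def by (intro sum.cong) auto

lemma quad_form_matrix_apply: "quad_form N a x = (\<Sum>i<N. (\<Sum>j<N. a i j * x j) * x i)"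
  unfolding quad_form_def by (simp add: sum_distrib_left mult_ac)

lemma quad_form_add_scaled:
  assumes sym: "\<And>i j. a i j = a j i"
  shows "quad_form N a (\<lambda>i. x i + t * y i) =
    quad_form N a x + 2 * t * (\<Sum>i<N. (\<Sum>j<N. a i j * x j) * y i) + t\<^sup>2 * quad_form N a y"
proof -
  have 1: "(\<Sum>i<N. \<Sum>j<N. a i j * x i * y j) = (\<Sum>i<N. \<Sum>j<N. a i j * y i * x j)"
    by (subst sum.swap) (simp add: sym mult_ac)
  have 2: "(\<Sum>i<N. (\<Sum>j<N. a i j * x j) * y i) = (\<Sum>i<N. \<Sum>j<N. a i j * y i * x j)"
    by (simp add: sum_distrib_left mult_ac)
  have "quad_form N a (\<lambda>i. x i + t * y i) =
     (\<Sum>i<N. \<Sum>j<N. a i j * x i * x j + t * (a i j * x i * y j) + t * (a i j * y i * x j)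
        + t\<^sup>2 * (a i j * y i * y j))"
    unfolding quad_form_def by (simp add: algebra_simps power2_eq_square)
  also have "\<dots> = quad_form N a x + t * (\<Sum>i<N. \<Sum>j<N. a i j * x i * y j)
      + t * (\<Sum>i<N. \<Sum>j<N. a i j * y i * x j) + t\<^sup>2 * quad_form N a y"
    unfolding quad_form_def by (simp add: sum.distrib sum_distrib_left)
  finally show ?thesis by (simp add: 1 2)
qed

text \<open>Compactness of the unit sphere. Vectors are functions on all of \<open>nat\<close>, so
  the sphere is taken inside a cube that is compact by Tychonoff's theorem; homogeneity then carries
  the bound to every \<open>y\<close>.\<close>

lemma quad_form_attains_max:
  assumes "N > 0"
  obtains x where "(\<Sum>i<N. (x i)\<^sup>2) = 1"
    and "\<And>y. quad_form N a y \<le> quad_form N a x * (\<Sum>i<N. (y i)\<^sup>2)"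
proof -
  define S where "S = PiE UNIV (\<lambda>i::nat. {-1..1::real}) \<inter> {x. (\<Sum>i<N. (x i)\<^sup>2) = 1}"
  have "compactin (product_topology (\<lambda>i::nat. euclidean) UNIV) (PiE UNIV (\<lambda>i::nat. {-1..1::real}))"
    by (subst compactin_PiE) simp
  then have "compact (PiE UNIV (\<lambda>i::nat. {-1..1::real}))"
    by (simp add: euclidean_product_topology)
  moreover have "closed {x. (\<Sum>i<N. (x i)\<^sup>2) = (1::real)}"
    by (intro closed_Collect_eq continuous_intros continuous_on_product_coordinates)
  ultimately have cS: "compact S" unfolding S_def by (rule compact_Int_closed)
  have "(\<lambda>i. if i = 0 then 1 else 0) \<in> S"
    using assms by (auto simp: S_def if_distrib[of "\<lambda>x. x\<^sup>2"] sum.delta cong: if_cong)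
  then have "S \<noteq> {}" by auto
  moreover have "continuous_on S (quad_form N a)"
    unfolding quad_form_def by (intro continuous_intros continuous_on_product_coordinates)
      (auto intro: continuous_on_subset[OF continuous_on_product_coordinates])
  ultimately obtain x where x: "x \<in> S" "\<And>y. y \<in> S \<Longrightarrow> quad_form N a y \<le> quad_form N a x"
    using continuous_attains_sup[OF cS] by blast
  show ?thesis
  proof
    show "(\<Sum>i<N. (x i)\<^sup>2) = 1" using x(1) by (simp add: S_def)
    fix y :: "nat \<Rightarrow> real"
    let ?r = "\<Sum>i<N. (y i)\<^sup>2"
    have r0: "?r \<ge> 0" by (intro sum_nonneg) auto
    show "quad_form N a y \<le> quad_form N a x * ?r"
    proof (cases "?r = 0")
      case True
      then have "y i = 0" if "i < N" for i
        using that by (subst (asm) sum_nonneg_eq_0_iff) auto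
      then show ?thesis using True by (simp add: quad_form_def)
    next
      case False
      with r0 have r: "?r > 0" by simp
      \<comment> \<open>The quadratic form ignores coordinates from \<open>N\<close> on; setting
        them to 0 puts \<open>z\<close> into the cube.\<close>
      define z where "z i = (if i < N then (1 / sqrt ?r) * y i else 0)" for i
      have le: "(y i)\<^sup>2 \<le> ?r" if "i < N" for i
        using that by (intro member_le_sum) auto
      have "\<bar>z i\<bar> \<le> 1" for i
        using real_sqrt_le_mono[OF le[of i]] r by (auto simp: z_def field_simps abs_mult)
      then have "z i \<in> {-1..1}" for i
        using abs_le_iff[of "z i" 1] by force
      moreover have "(\<Sum>i<N. (z i)\<^sup>2) = 1"
      proof -
        have "(\<Sum>i<N. (z i)\<^sup>2) = (\<Sum>i<N. (y i)\<^sup>2 / ?r)"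
          using r by (intro sum.cong) (auto simp: z_def power_mult_distrib power_divide)
        also have "\<dots> = 1" using r by (simp flip: sum_divide_distrib)
        finally show ?thesis .
      qed
      ultimately have "quad_form N a z \<le> quad_form N a x"
        by (intro x(2)) (simp add: S_def PiE_UNIV_domain)
      moreover have "quad_form N a z = quad_form N a (\<lambda>i. (1 / sqrt ?r) * y i)"
        by (intro quad_form_cong) (simp add: z_def)
      then have "quad_form N a z = quad_form N a y / ?r"
        using r by (simp only: quad_form_scale) (simp add: power_divide)
      ultimately show ?thesis using r by (simp add: field_simps)
    qed
  qed
qed

text \<open>First variation without derivatives. Along x + t r, with \<open>r\<close> the residual,
  the gap in the Rayleigh bound is a quadratic in \<open>t\<close> without constant term. It never
  becomes negative, so its linear coefficient \<open>2 * s\<close>, with s = |r|^2,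
  vanishes.\<close>

lemma quad_form_max_eigenvector:
  assumes sym: "\<And>i j. a i j = a j i"
    and nx: "(\<Sum>i<N. (x i)\<^sup>2) = 1"
    and mx: "\<And>y. quad_form N a y \<le> quad_form N a x * (\<Sum>i<N. (y i)\<^sup>2)"
    and i: "i < N"
  shows "(\<Sum>j<N. a i j * x j) = quad_form N a x * x i"
proof -
  define \<mu> where "\<mu> = quad_form N a x"
  define r where "r i = \<mu> * x i - (\<Sum>j<N. a i j * x j)" for i
  define s where "s = (\<Sum>i<N. (r i)\<^sup>2)"
  define Q where "Q = \<mu> * s - quad_form N a r"
  have Q0: "Q \<ge> 0" using mx[of r] by (simp add: Q_def s_def \<mu>_def)
  have s0: "s \<ge> 0" unfolding s_def by (intro sum_nonneg) auto
  have key: "2 * t * s + t\<^sup>2 * Q \<ge> 0" for t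
  proof -
    define P where "P = (\<Sum>i<N. x i * r i)"
    define A where "A = (\<Sum>i<N. (\<Sum>j<N. a i j * x j) * r i)"
    have norm: "(\<Sum>i<N. (x i + t * r i)\<^sup>2) = 1 + 2 * t * P + t\<^sup>2 * s"
      unfolding s_def P_def nx[symmetric]
      by (simp add: power2_eq_square algebra_simps sum.distrib sum_distrib_left)
    have "(r i)\<^sup>2 = \<mu> * (x i * r i) - (\<Sum>j<N. a i j * x j) * r i" for i
      unfolding power2_eq_square by (subst (1) r_def) (simp add: algebra_simps)
    then have "s = \<mu> * P - A"
      unfolding s_def P_def A_def by (simp add: sum_subtractf sum_distrib_left)
    then have "2 * t * s = 2 * t * (\<mu> * P - A)" by (simp only:)
    moreover have "\<mu> + 2 * t * A + t\<^sup>2 * quad_form N a r \<le> \<mu> * (1 + 2 * t * P + t\<^sup>2 * s)"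
      using mx[of "\<lambda>i. x i + t * r i"]
      unfolding norm quad_form_add_scaled[OF sym] by (simp only: \<mu>_def A_def)
    ultimately show ?thesis by (simp add: Q_def algebra_simps)
  qed
  have "s = 0"
  proof (cases "Q = 0")
    case True then show ?thesis using key[of "-1"] s0 by simp
  next
    case False
    \<comment> \<open>\<open>- s / Q\<close> minimises the quadratic in \<open>key\<close>.\<close>
    then have "2 * (- s / Q) * s + (- s / Q)\<^sup>2 * Q = - s\<^sup>2 / Q"
      by (simp add: field_simps power2_eq_square)
    then have "s\<^sup>2 / Q \<le> 0" using key[of "- s / Q"] by simp
    then show ?thesis using False Q0
      by (simp add: divide_le_0_iff)
  qed
  then have "r i = 0" unfolding s_def using i by (subst (asm) sum_nonneg_eq_0_iff) auto
  then show ?thesis by (simp add: r_def \<mu>_def)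
qed

lemma mult_mat_vec_index_sum:
  assumes "v \<in> carrier_vec N" "i < N"
  shows "(mat N N (\<lambda>(i, j). a i j) *\<^sub>v v) $ i = (\<Sum>j<N. a i j * v $ j)"
  using assms by (auto simp: scalar_prod_def lessThan_atLeast0 intro!: sum.cong)

text \<open>The maximiser is an eigenvector, and every eigenvalue is the Rayleigh quotient of its
  eigenvectors.\<close>

lemma largest_eigenvalue_eq_max:
  fixes a :: "nat \<Rightarrow> nat \<Rightarrow> real"
  assumes sym: "\<And>i j. a i j = a j i"
    and nx: "(\<Sum>i<N. (x i)\<^sup>2) = 1"
    and mx: "\<And>y. quad_form N a y \<le> quad_form N a x * (\<Sum>i<N. (y i)\<^sup>2)"
  shows "largest_eigenvalue (mat N N (\<lambda>(i, j). a i j)) = quad_form N a x"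
  unfolding largest_eigenvalue_def
proof (rule Max_eqI)
  let ?A = "mat N N (\<lambda>(i, j). a i j)"
  have A: "?A \<in> carrier_mat N N" by simp
  \<comment> \<open>\<open>Max\<close> needs a finite set: the eigenvalues are roots of a nonzero
    polynomial.\<close>
  have "char_poly ?A \<noteq> 0" using degree_monic_char_poly[OF A] by auto
  then show "finite {l. eigenvalue ?A l}"
    using poly_roots_finite by (simp add: eigenvalue_root_char_poly[OF A])
  have "eigenvector ?A (vec N x) (quad_form N a x)"
    unfolding eigenvector_def
  proof (intro conjI)
    show "vec N x \<noteq> 0\<^sub>v (dim_row ?A)"
    proof
      assume "vec N x = 0\<^sub>v (dim_row ?A)"
      then have "vec N x $ i = 0\<^sub>v N $ i" for i by simp
      then have "x i = 0" if "i < N" for i using that by (metis index_vec index_zero_vec(1))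
      with nx show False by simp
    qed
    show "?A *\<^sub>v vec N x = quad_form N a x \<cdot>\<^sub>v vec N x"
    proof (rule eq_vecI)
      fix i assume "i < dim_vec (quad_form N a x \<cdot>\<^sub>v vec N x)"
      then have i: "i < N" by simp
      show "(?A *\<^sub>v vec N x) $ i = (quad_form N a x \<cdot>\<^sub>v vec N x) $ i"
        using quad_form_max_eigenvector[OF sym nx mx i] i
        by (subst mult_mat_vec_index_sum) auto
    qed simp
  qed simp
  then show "quad_form N a x \<in> {l. eigenvalue ?A l}" by (auto simp: eigenvalue_def)
  fix l assume "l \<in> {l. eigenvalue ?A l}"
  then obtain v where v: "v \<in> carrier_vec N" "v \<noteq> 0\<^sub>v N" "?A *\<^sub>v v = l \<cdot>\<^sub>v v"
    by (auto simp: eigenvalue_def eigenvector_def)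
  let ?y = "\<lambda>i. v $ i"
  have "(\<Sum>j<N. a i j * v $ j) = l * v $ i" if "i < N" for i
    using mult_mat_vec_index_sum[OF v(1) that, of a] v that by simp
  then have "quad_form N a ?y = l * (\<Sum>i<N. (?y i)\<^sup>2)"
    by (simp add: quad_form_matrix_apply sum_distrib_left power2_eq_square mult_ac)
  moreover have "(\<Sum>i<N. (?y i)\<^sup>2) > 0"
  proof -
    obtain i where "i < N" "v $ i \<noteq> 0"
      using v(1,2) by (metis carrier_vecD eq_vecI index_zero_vec)
    then show ?thesis by (intro sum_pos2[of _ i]) auto
  qed
  ultimately show "l \<le> quad_form N a x" using mx[of ?y] by simp
qed

text \<open>The interface to the perturbation bounds: a trial vector in the second part bounds the
  eigenvalue from below, and decomposing the maximiser of the first part bounds it from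
  above.\<close>

lemma largest_eigenvalue_variational:
  fixes a :: "nat \<Rightarrow> nat \<Rightarrow> real"
  assumes sym: "\<And>i j. a i j = a j i" and N: "N > 0"
  defines "\<mu> \<equiv> largest_eigenvalue (mat N N (\<lambda>(i, j). a i j))"
  shows "\<exists>x. (\<Sum>i<N. (x i)\<^sup>2) = 1 \<and> quad_form N a x = \<mu>"
    and "quad_form N a y \<le> \<mu> * (\<Sum>i<N. (y i)\<^sup>2)"
proof -
  obtain x where x: "(\<Sum>i<N. (x i)\<^sup>2) = 1"
      "\<And>y. quad_form N a y \<le> quad_form N a x * (\<Sum>i<N. (y i)\<^sup>2)"
    using quad_form_attains_max[OF N] by metis
  note eq = largest_eigenvalue_eq_max[OF sym x]
  show "\<exists>x. (\<Sum>i<N. (x i)\<^sup>2) = 1 \<and> quad_form N a x = \<mu>"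
    and "quad_form N a y \<le> \<mu> * (\<Sum>i<N. (y i)\<^sup>2)"
    using x by (auto simp: \<mu>_def eq)
qed

text \<open>By homogeneity the Rayleigh bound only needs integer vectors: a countable condition, hence measurability.\<close>
lemma quad_form_le_if_int_vectors:
  assumes "\<And>y. y \<in> PiE {..<N} (\<lambda>_. UNIV :: int set) \<Longrightarrow>
     quad_form N a (\<lambda>i. real_of_int (y i)) \<le> t * (\<Sum>i<N. (real_of_int (y i))\<^sup>2)"
  shows "quad_form N a x \<le> t * (\<Sum>i<N. (x i)\<^sup>2)"
proof -
  \<comment> \<open>Rounding down to a grid of mesh 1 / (n + 1); multiplied by \<open>Suc n\<close>,
    the approximation is an integer vector.\<close>
  define z where "z n i = real_of_int \<lfloor>real (Suc n) * x i\<rfloor> / real (Suc n)" for n i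
  have lim: "(\<lambda>n. z n i) \<longlonglongrightarrow> x i" for i
  proof (rule tendsto_sandwich[where f = "\<lambda>n. x i - 1 / real (Suc n)" and h = "\<lambda>n. x i"])
    have "x i - 1 / real (Suc n) \<le> z n i" for n
    proof -
      have "(real (Suc n) * x i - 1) / real (Suc n) \<le> z n i"
        unfolding z_def using floor_correct[of "real (Suc n) * x i"] by (intro divide_right_mono) auto
      then show ?thesis by (simp add: diff_divide_distrib del: of_nat_Suc)
    qed
    then show "\<forall>\<^sub>F n in sequentially. x i - 1 / real (Suc n) \<le> z n i" by simp
    have "z n i \<le> x i" for n
      using floor_correct[of "real (Suc n) * x i"] by (simp add: z_def field_simps)
    then show "\<forall>\<^sub>F n in sequentially. z n i \<le> x i" by simp
    have "(\<lambda>n. x i - 1 / real (Suc n)) \<longlonglongrightarrow> x i - 0"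
      by (intro tendsto_intros LIMSEQ_Suc[OF lim_1_over_n])
    then show "(\<lambda>n. x i - 1 / real (Suc n)) \<longlonglongrightarrow> x i" by simp
  qed simp
  have le: "quad_form N a (z n) \<le> t * (\<Sum>i<N. (z n i)\<^sup>2)" for n
  proof -
    define y where "y = restrict (\<lambda>i. \<lfloor>real (Suc n) * x i\<rfloor>) {..<N}"
    define c where "c = 1 / real (Suc n)"
    have z: "z n i = c * real_of_int (y i)" if "i < N" for i
      using that by (simp add: y_def z_def c_def)
    have "quad_form N a (z n) = c\<^sup>2 * quad_form N a (\<lambda>i. real_of_int (y i))"
      by (subst quad_form_scale[symmetric]) (intro quad_form_cong z)
    also have "\<dots> \<le> c\<^sup>2 * (t * (\<Sum>i<N. (real_of_int (y i))\<^sup>2))"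
      by (intro mult_left_mono assms) (simp_all only: y_def restrict_PiE_iff, auto)
    also have "\<dots> = t * (\<Sum>i<N. (z n i)\<^sup>2)"
      by (simp add: z power_mult_distrib sum_distrib_left mult_ac)
    finally show ?thesis .
  qed
  show ?thesis
  proof (rule LIMSEQ_le)
    show "(\<lambda>n. quad_form N a (z n)) \<longlonglongrightarrow> quad_form N a x"
      unfolding quad_form_def by (intro tendsto_intros lim)
    show "(\<lambda>n. t * (\<Sum>i<N. (z n i)\<^sup>2)) \<longlonglongrightarrow> t * (\<Sum>i<N. (x i)\<^sup>2)"
      by (intro tendsto_intros lim)
  qed (use le in auto)
qed

text \<open>Each sublevel set is a countable intersection of events about quadratic forms.
  Measurability is what makes \<open>distr\<close> the actual law of the eigenvalue.\<close>

lemma measurable_largest_eigenvalue: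
  fixes a :: "nat \<Rightarrow> nat \<Rightarrow> 'a \<Rightarrow> real"
  assumes sym: "\<And>i j \<omega>. a i j \<omega> = a j i \<omega>" and N: "N > 0"
    and [measurable]: "\<And>i j. a i j \<in> borel_measurable M"
  shows "(\<lambda>\<omega>. largest_eigenvalue (mat N N (\<lambda>(i, j). a i j \<omega>))) \<in> borel_measurable M"
proof (rule borel_measurable_iff_le[THEN iffD2], intro allI)
  fix t :: real
  let ?I = "PiE {..<N} (\<lambda>_. UNIV :: int set)"
  let ?L = "\<lambda>\<omega>. largest_eigenvalue (mat N N (\<lambda>(i, j). a i j \<omega>))"
  have c: "countable ?I" by (intro countable_PiE) auto
  have "?L \<omega> \<le> t \<longleftrightarrow> (\<forall>y\<in>?I. quad_form N (\<lambda>i j. a i j \<omega>) (\<lambda>i. real_of_int (y i))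
      \<le> t * (\<Sum>i<N. (real_of_int (y i))\<^sup>2))" for \<omega>
  proof
    assume L: "?L \<omega> \<le> t"
    have "quad_form N (\<lambda>i j. a i j \<omega>) y \<le> t * (\<Sum>i<N. (y i)\<^sup>2)" for y
      using largest_eigenvalue_variational(2)[of "\<lambda>i j. a i j \<omega>" N y, OF sym N]
        mult_right_mono[OF L, of "\<Sum>i<N. (y i)\<^sup>2"]
      by (simp add: sum_nonneg)
    then show "\<forall>y\<in>?I. quad_form N (\<lambda>i j. a i j \<omega>) (\<lambda>i. real_of_int (y i))
      \<le> t * (\<Sum>i<N. (real_of_int (y i))\<^sup>2)"
      by blast
  next
    assume "\<forall>y\<in>?I. quad_form N (\<lambda>i j. a i j \<omega>) (\<lambda>i. real_of_int (y i))
      \<le> t * (\<Sum>i<N. (real_of_int (y i))\<^sup>2)"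
    then have "quad_form N (\<lambda>i j. a i j \<omega>) x \<le> t * (\<Sum>i<N. (x i)\<^sup>2)" for x
      using quad_form_le_if_int_vectors[of N "\<lambda>i j. a i j \<omega>" t x] by blast
    then show "?L \<omega> \<le> t"
      using largest_eigenvalue_variational(1)[of "\<lambda>i j. a i j \<omega>", OF sym N] by (metis mult.right_neutral)
  qed
  then have "{\<omega> \<in> space M. ?L \<omega> \<le> t} = {\<omega> \<in> space M. \<forall>y\<in>?I.
     quad_form N (\<lambda>i j. a i j \<omega>) (\<lambda>i. real_of_int (y i)) \<le> t * (\<Sum>i<N. (real_of_int (y i))\<^sup>2)}"
    by simp
  also have "\<dots> \<in> sets M"
  proof (rule sets.sets_Collect_countable_All'[OF _ c])
    fix y :: "nat \<Rightarrow> int"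
    show "{\<omega> \<in> space M. quad_form N (\<lambda>i j. a i j \<omega>) (\<lambda>i. real_of_int (y i))
        \<le> t * (\<Sum>i<N. (real_of_int (y i))\<^sup>2)} \<in> sets M"
      unfolding quad_form_def by measurable
  qed
  finally show "{\<omega> \<in> space M. ?L \<omega> \<le> t} \<in> sets M" .
qed

section \<open>Perturbation of a rank-one matrix\<close>

text \<open>The hypothesis bounds the trace of \<open>W\<^sup>4\<close>, hence the fourth power of the operator norm of \<open>W\<close>.\<close>
lemma quad_form_le_fourth_root:
  assumes sym: "\<And>i j. W i j = W j i" and \<rho>: "\<rho> \<ge> 0"
    and T: "(\<Sum>i<N. \<Sum>k<N. (\<Sum>j<N. W i j * W j k)\<^sup>2) \<le> \<rho> ^ 4"
  shows "\<bar>quad_form N W y\<bar> \<le> \<rho> * (\<Sum>i<N. (y i)\<^sup>2)"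
proof -
  define Y where "Y = (\<Sum>i<N. (y i)\<^sup>2)"
  define V where "V i k = (\<Sum>j<N. W i j * W j k)" for i k
  have Y0: "Y \<ge> 0" unfolding Y_def by (intro sum_nonneg) auto
  have "(\<Sum>i<N. (\<Sum>j<N. W i j * y j)\<^sup>2) = quad_form N V y"
  proof -
    have "(\<Sum>i<N. (\<Sum>j<N. W i j * y j)\<^sup>2) = (\<Sum>i<N. \<Sum>j<N. \<Sum>k<N. W j i * W i k * y j * y k)"
      unfolding power2_eq_square sum_product by (simp add: sym mult_ac)
    also have "\<dots> = (\<Sum>j<N. \<Sum>k<N. \<Sum>i<N. W j i * W i k * y j * y k)"
      by (subst sum.swap, rule sum.cong[OF refl], rule sum.swap)
    also have "\<dots> = quad_form N V y"
      unfolding quad_form_def V_def by (simp add: sum_distrib_right)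
    finally show ?thesis .
  qed
  \<comment> \<open>Cauchy-Schwarz over index pairs: the quadratic form of \<open>V\<close>, the
    matrix W^2, is dominated by its Hilbert-Schmidt norm, whose square is the trace of W^4.\<close>
  also have "quad_form N V y \<le> \<rho>\<^sup>2 * Y"
  proof (rule power2_le_imp_le)
    have "(quad_form N V y)\<^sup>2 = (\<Sum>p\<in>{..<N}\<times>{..<N}. V (fst p) (snd p) * (y (fst p) * y (snd p)))\<^sup>2"
      unfolding quad_form_def by (simp add: sum.cartesian_product case_prod_unfold mult_ac)
    also have "\<dots> \<le> (\<Sum>p\<in>{..<N}\<times>{..<N}. (V (fst p) (snd p))\<^sup>2) * (\<Sum>p\<in>{..<N}\<times>{..<N}. (y (fst p) * y (snd p))\<^sup>2)"
      by (rule Cauchy_Schwarz_ineq_sum)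
    also have "(\<Sum>p\<in>{..<N}\<times>{..<N}. (y (fst p) * y (snd p))\<^sup>2) = Y\<^sup>2"
      unfolding Y_def power2_eq_square[of "sum _ _"] sum_product
      by (simp add: sum.cartesian_product case_prod_unfold power_mult_distrib)
    also have "(\<Sum>p\<in>{..<N}\<times>{..<N}. (V (fst p) (snd p))\<^sup>2) = (\<Sum>i<N. \<Sum>k<N. (V i k)\<^sup>2)"
      by (simp add: sum.cartesian_product case_prod_unfold)
    also have "\<dots> * Y\<^sup>2 \<le> \<rho> ^ 4 * Y\<^sup>2"
      using T by (intro mult_right_mono) (auto simp: V_def)
    also have "\<dots> = (\<rho>\<^sup>2 * Y)\<^sup>2" by (simp add: power_mult_distrib flip: power_mult)
    finally show "(quad_form N V y)\<^sup>2 \<le> (\<rho>\<^sup>2 * Y)\<^sup>2" .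
  qed (use Y0 in auto)
  finally have *: "(\<Sum>i<N. (\<Sum>j<N. W i j * y j)\<^sup>2) \<le> \<rho>\<^sup>2 * Y" .
  have "(quad_form N W y)\<^sup>2 \<le> (\<Sum>i<N. (\<Sum>j<N. W i j * y j)\<^sup>2) * Y"
    unfolding quad_form_matrix_apply Y_def by (rule Cauchy_Schwarz_ineq_sum)
  also have "\<dots> \<le> \<rho>\<^sup>2 * Y * Y" using * Y0 by (intro mult_right_mono)
  also have "\<dots> = (\<rho> * Y)\<^sup>2" by (simp add: power2_eq_square)
  finally have "\<bar>quad_form N W y\<bar> \<le> \<bar>\<rho> * Y\<bar>" by (simp only: abs_le_square_iff)
  then show ?thesis using \<rho> Y0 by (simp add: Y_def)
qed

text \<open>The deterministic half: \<open>W\<close> is one realisation of the centred matrix and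
  \<open>c\<close> stands for 2 \<theta>. The unperturbed matrix has the all-ones vector as top
  eigenvector, with eigenvalue \<open>m\<close>.\<close>

locale rank_one_perturbation =
  fixes W :: "nat \<Rightarrow> nat \<Rightarrow> real" and N :: nat and c \<rho> :: real
  assumes sym: "\<And>i j. W i j = W j i"
    and N: "N > 0" and c: "c > 0" and \<rho>: "\<rho> \<ge> 0"
    and qf_le: "\<And>y. \<bar>quad_form N W y\<bar> \<le> \<rho> * (\<Sum>i<N. (y i)\<^sup>2)"
begin

definition rowsum :: "nat \<Rightarrow> real" where "rowsum i = (\<Sum>j<N. W i j)"
definition s where "s = (\<Sum>i<N. rowsum i) / N"
text \<open>The empirical variance of the row sums, equal to |w|^2 / N by \<open>w_w\<close>. Thus
  \<open>p / m\<close> is the second-order term of perturbation theory, \<open>m\<close> being the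
  gap to the other eigenvalues, all 0.\<close>

definition p where "p = (\<Sum>i<N. (rowsum i)\<^sup>2) / N - s\<^sup>2"
definition m where "m = c * N"
definition top_eig where "top_eig = largest_eigenvalue (mat N N (\<lambda>(i, j). c + W i j))"

text \<open>The component of \<open>W1\<close> orthogonal to the all-ones vector \<open>1\<close>.\<close>
definition w where "w i = rowsum i - s"

lemma sum_rowsum: "(\<Sum>i<N. rowsum i) = s * N" using N by (simp add: s_def)

lemma sum_w: "(\<Sum>i<N. w i) = 0"
  by (simp add: w_def sum_subtractf sum_rowsum)

lemma row_w: "(\<Sum>i<N. rowsum i * w i) = N * p"
proof -
  have "(\<Sum>i<N. rowsum i * w i) = (\<Sum>i<N. (rowsum i)\<^sup>2) - s * (\<Sum>i<N. rowsum i)"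
    by (simp add: w_def algebra_simps power2_eq_square sum_subtractf sum_distrib_left)
  also have "\<dots> = N * p" using N by (simp add: sum_rowsum p_def power2_eq_square right_diff_distrib)
  finally show ?thesis .
qed

lemma w_w: "(\<Sum>i<N. (w i)\<^sup>2) = N * p"
proof -
  have "(w i)\<^sup>2 = rowsum i * w i - s * w i" for i
    by (simp add: w_def algebra_simps power2_eq_square)
  then have "(\<Sum>i<N. (w i)\<^sup>2) = (\<Sum>i<N. rowsum i * w i) - s * (\<Sum>i<N. w i)"
    by (simp add: sum_subtractf sum_distrib_left)
  then show ?thesis by (simp add: row_w sum_w)
qed

lemma p_nonneg: "p \<ge> 0"
proof -
  have "N * p \<ge> 0" unfolding w_w[symmetric] by (intro sum_nonneg) auto
  then show ?thesis using N by (simp add: zero_le_mult_iff)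
qed

lemma m_pos: "m > 0" using N c by (simp add: m_def)

lemma quad_form_shift: "quad_form N (\<lambda>i j. c + W i j) x = c * (\<Sum>i<N. x i)\<^sup>2 + quad_form N W x"
  unfolding quad_form_def power2_eq_square sum_product
  by (simp add: algebra_simps sum.distrib sum_distrib_left)

lemma quad_form_one_plus:
  "quad_form N W (\<lambda>i. b + y i) = b\<^sup>2 * (s * N) + 2 * b * (\<Sum>i<N. rowsum i * y i) + quad_form N W y"
proof -
  have "quad_form N W (\<lambda>i. b) = b\<^sup>2 * (s * N)"
    unfolding quad_form_def sum_rowsum[symmetric] by (simp add: rowsum_def sum_distrib_left power2_eq_square mult_ac)
  moreover have "(\<Sum>i<N. (\<Sum>j<N. W i j * b) * y i) = b * (\<Sum>i<N. rowsum i * y i)"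
    by (simp add: rowsum_def sum_distrib_left sum_distrib_right mult_ac)
  ultimately show ?thesis
    using quad_form_add_scaled[of W N "\<lambda>_. b" 1 y, OF sym] by simp
qed

text \<open>Rayleigh quotient at the first-order perturbed eigenvector \<open>1 + w / m\<close>.\<close>
lemma top_eig_ge:
  "top_eig \<ge> m + s + p / m - (\<rho> * p / m\<^sup>2 + \<bar>s\<bar> * p / m\<^sup>2 + p\<^sup>2 / m ^ 3)"
proof -
  let ?u = "\<lambda>i. 1 + (1 / m) * w i"
  let ?e = "\<rho> * p / m\<^sup>2 + \<bar>s\<bar> * p / m\<^sup>2 + p\<^sup>2 / m ^ 3"
  have sw: "(\<Sum>i<N. ?u i) = N" by (simp add: sum.distrib sum_w flip: sum_distrib_left sum_divide_distrib)
  have "(\<Sum>i<N. (?u i)\<^sup>2) = (\<Sum>i<N. 1 + 2 / m * w i + 1 / m\<^sup>2 * (w i)\<^sup>2)"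
    by (intro sum.cong) (auto simp: power2_eq_square algebra_simps)
  also have "\<dots> = N + 2 / m * (\<Sum>i<N. w i) + 1 / m\<^sup>2 * (\<Sum>i<N. (w i)\<^sup>2)"
    by (simp only: sum.distrib sum_distrib_left) simp
  finally have nu: "(\<Sum>i<N. (?u i)\<^sup>2) = N * (1 + p / m\<^sup>2)"
    by (simp add: sum_w w_w algebra_simps)
  have "(\<Sum>i<N. rowsum i * ((1 / m) * w i)) = (1 / m) * (\<Sum>i<N. rowsum i * w i)"
    by (subst sum_distrib_left) (simp add: mult_ac)
  then have rw: "(\<Sum>i<N. rowsum i * ((1 / m) * w i)) = N * p / m"
    by (simp add: row_w)
  have "N * (m + s + 2 * p / m - \<rho> * p / m\<^sup>2) \<le> quad_form N (\<lambda>i j. c + W i j) ?u"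
  proof -
    have "quad_form N W w \<ge> - \<rho> * (N * p)"
      using qf_le[of w] by (simp add: w_w)
    then have "(1 / m)\<^sup>2 * quad_form N W w \<ge> (1 / m)\<^sup>2 * (- \<rho> * (N * p))"
      by (intro mult_left_mono) auto
    then show ?thesis
      unfolding quad_form_shift quad_form_one_plus sw rw quad_form_scale
      using N by (simp add: m_def algebra_simps power2_eq_square)
  qed
  also have "\<dots> \<le> top_eig * (N * (1 + p / m\<^sup>2))"
    unfolding top_eig_def nu[symmetric] by (intro largest_eigenvalue_variational) (auto simp: sym N)
  finally have "m + s + 2 * p / m - \<rho> * p / m\<^sup>2 \<le> top_eig * (1 + p / m\<^sup>2)"
    using N by (simp add: mult.left_commute)
  \<comment> \<open>The last two terms of \<open>?e\<close> absorb what multiplication by 1 + p /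
    m^2 creates beyond \<open>2 * p / m\<close>; its first term is the possible loss from the
    quadratic form of \<open>W\<close> at \<open>w\<close>.\<close>
  moreover have "(m + s + p / m - ?e) * (1 + p / m\<^sup>2) \<le> m + s + 2 * p / m - \<rho> * p / m\<^sup>2"
  proof -
    have e0: "?e \<ge> 0" using \<rho> p_nonneg m_pos by (intro add_nonneg_nonneg) auto
    have "(m + s + p / m - ?e) * (1 + p / m\<^sup>2)
      = m + s + 2 * p / m + s * p / m\<^sup>2 + p\<^sup>2 / m ^ 3 - ?e - ?e * (p / m\<^sup>2)"
    proof -
      have "(m + s + p / m) * (1 + p / m\<^sup>2) = m + s + 2 * p / m + s * p / m\<^sup>2 + p\<^sup>2 / m ^ 3"
        using m_pos by (simp add: field_simps power2_eq_square power3_eq_cube)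
      then show ?thesis by (simp only: left_diff_distrib) (simp add: distrib_left)
    qed
    moreover have "?e * (p / m\<^sup>2) \<ge> 0" using e0 p_nonneg by (intro mult_nonneg_nonneg) auto
    moreover have "s * p / m\<^sup>2 \<le> \<bar>s\<bar> * p / m\<^sup>2"
      using p_nonneg by (intro divide_right_mono mult_right_mono) auto
    ultimately show ?thesis by linarith
  qed
  ultimately have "(m + s + p / m - ?e) * (1 + p / m\<^sup>2) \<le> top_eig * (1 + p / m\<^sup>2)"
    by linarith
  moreover have "1 + p / m\<^sup>2 > 0" using p_nonneg by (simp add: add_pos_nonneg)
  ultimately show ?thesis by (simp only: mult_le_cancel_right_pos)
qed

text \<open>On \<open>b \<cdot> 1 + y\<close> with \<open>y\<close> orthogonal to \<open>1\<close>, the cross term is split by AM-GM with weight \<open>m + s - \<rho>\<close>,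
  chosen so that the coefficient of \<open>|y|\<^sup>2\<close> becomes \<open>m + s\<close>.\<close>
lemma top_eig_le:
  assumes D: "m + s - \<rho> > 0"
  shows "top_eig \<le> m + s + p / (m + s - \<rho>)"
proof -
  let ?D = "m + s - \<rho>"
  obtain x where x: "(\<Sum>i<N. (x i)\<^sup>2) = 1" "quad_form N (\<lambda>i j. c + W i j) x = top_eig"
    using largest_eigenvalue_variational(1)[of "\<lambda>i j. c + W i j" N] sym N
    unfolding top_eig_def by auto
  define b where "b = (\<Sum>i<N. x i) / N"
  define y where "y i = x i - b" for i
  define Y where "Y = (\<Sum>i<N. (y i)\<^sup>2)"
  have sx: "(\<Sum>i<N. x i) = b * N" using N by (simp add: b_def)
  have sy: "(\<Sum>i<N. y i) = 0" by (simp add: y_def sum_subtractf sx)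
  have xy: "x = (\<lambda>i. b + y i)" by (simp add: y_def)
  have nx: "N * b\<^sup>2 + Y = 1"
  proof -
    have "(\<Sum>i<N. (x i)\<^sup>2) = (\<Sum>i<N. b\<^sup>2 + 2 * b * y i + (y i)\<^sup>2)"
      unfolding xy by (simp add: power2_sum algebra_simps)
    also have "\<dots> = N * b\<^sup>2 + 2 * b * (\<Sum>i<N. y i) + Y"
      unfolding Y_def by (simp only: sum.distrib sum_distrib_left) simp
    finally show ?thesis using x(1) by (simp add: sy)
  qed
  \<comment> \<open>Only the part of W1 orthogonal to 1 couples to \<open>y\<close>.\<close>
  have rwy: "(\<Sum>i<N. rowsum i * y i) = (\<Sum>i<N. w i * y i)"
    using sy by (simp add: w_def left_diff_distrib sum_subtractf flip: sum_distrib_left)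
  have amgm: "2 * b * (\<Sum>i<N. w i * y i) \<le> b\<^sup>2 * (N * p) / ?D + ?D * Y"
  proof -
    have "0 \<le> (\<Sum>i<N. (b * w i - ?D * y i)\<^sup>2)" by (intro sum_nonneg) auto
    also have "\<dots> = (\<Sum>i<N. b\<^sup>2 * (w i)\<^sup>2 + ?D\<^sup>2 * (y i)\<^sup>2 - 2 * b * ?D * (w i * y i))"
      by (intro sum.cong) (auto simp: power2_eq_square algebra_simps)
    also have "\<dots> = b\<^sup>2 * (N * p) + ?D\<^sup>2 * Y - 2 * b * ?D * (\<Sum>i<N. w i * y i)"
      unfolding Y_def w_w[symmetric] by (simp only: sum.distrib sum_subtractf sum_distrib_left)
    finally have "?D * (2 * b * (\<Sum>i<N. w i * y i)) \<le> b\<^sup>2 * (N * p) + ?D * (?D * Y)"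
      by (simp add: power2_eq_square algebra_simps)
    also have "\<dots> = ?D * (b\<^sup>2 * (N * p) / ?D + ?D * Y)"
      using D by (simp only: distrib_left) simp
    finally have "?D * (2 * b * (\<Sum>i<N. w i * y i)) \<le> ?D * (b\<^sup>2 * (N * p) / ?D + ?D * Y)" .
    then show ?thesis using D by (simp only: mult_le_cancel_left_pos)
  qed
  have "top_eig = c * (b * N)\<^sup>2 + (b\<^sup>2 * (s * N) + 2 * b * (\<Sum>i<N. w i * y i) + quad_form N W y)"
    unfolding x(2)[symmetric] quad_form_shift sx by (subst xy) (simp only: quad_form_one_plus rwy)
  also have "\<dots> \<le> c * (b * N)\<^sup>2 + (b\<^sup>2 * (s * N) + (b\<^sup>2 * (N * p) / ?D + ?D * Y) + \<rho> * Y)"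
    using amgm qf_le[of y] by (simp add: Y_def)
  also have "\<dots> = (N * b\<^sup>2 + Y) * (m + s) + N * b\<^sup>2 * (p / ?D)"
    by (simp add: m_def algebra_simps power2_eq_square)
  also have "\<dots> \<le> (m + s) + 1 * (p / ?D)"
  proof -
    have "N * b\<^sup>2 \<le> 1" using nx unfolding Y_def by (smt (verit) sum_nonneg zero_le_power2)
    then have "N * b\<^sup>2 * (p / ?D) \<le> 1 * (p / ?D)"
      using p_nonneg D by (intro mult_right_mono) auto
    then show ?thesis by (simp add: nx)
  qed
  finally show ?thesis by simp
qed

text \<open>Each quantity is measured at its natural scale, so \<open>N\<close> cancels and the
  error depends on \<delta>, \<kappa> and \<open>c\<close> alone. The bound on
  \<open>s\<^sup>2\<close> serves twice: it makes s^2 / N negligible in p / N, and it keeps |s|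
  below \<delta> N. The bound on 1 / N pays for p^2 / m^3. In \<open>c - 2 * \<delta>\<close> one
  \<delta> is the share of \<open>s\<close>, the other that of \<rho>.\<close>

lemma top_eig_error:
  fixes \<delta> \<kappa> :: real
  assumes \<delta>: "\<delta> > 0" "2 * \<delta> < c" and N\<delta>: "1 / N \<le> \<delta>" and \<rho>_eq: "\<rho> = \<delta> * N"
    and s_small: "s\<^sup>2 \<le> \<delta>\<^sup>2 * N"
    and q: "\<bar>(\<Sum>i<N. (rowsum i)\<^sup>2) / N\<^sup>2 - \<kappa>\<bar> \<le> \<delta>"
  shows "top_eig - m - s - \<kappa> / c \<le> (\<kappa> + \<delta>) / (c - 2 * \<delta>) - \<kappa> / c"
    and "top_eig - m - s - \<kappa> / c \<ge>
      - ((\<delta> + \<delta>\<^sup>2) / c + 2 * \<delta> * (\<kappa> + \<delta>) / c\<^sup>2 + \<delta> * (\<kappa> + \<delta>)\<^sup>2 / c ^ 3)"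
proof -
  define h where "h = p / N"
  have p: "p = h * N" using N by (simp add: h_def)
  have h: "h = (\<Sum>i<N. (rowsum i)\<^sup>2) / N\<^sup>2 - s\<^sup>2 / N"
    using N by (simp add: h_def p_def field_simps power2_eq_square)
  have h0: "h \<ge> 0" using p_nonneg by (simp add: h_def)
  have s2: "0 \<le> s\<^sup>2 / N" "s\<^sup>2 / N \<le> \<delta>\<^sup>2" using s_small N by (simp_all add: field_simps)
  have hu: "h \<le> \<kappa> + \<delta>" and hl: "h \<ge> \<kappa> - \<delta> - \<delta>\<^sup>2" using q h s2 by linarith+
  have abs_s: "\<bar>s\<bar> \<le> \<delta> * N"
  proof -
    have "s\<^sup>2 \<le> \<delta>\<^sup>2 * N * N" using s_small mult_left_mono[of 1 "real N" "\<delta>\<^sup>2 * N"] N by simp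
    then have "s\<^sup>2 \<le> (\<delta> * N)\<^sup>2" by (simp add: power2_eq_square mult_ac)
    then show ?thesis using \<delta> by (simp flip: abs_le_square_iff)
  qed
  have D: "m + s - \<rho> \<ge> (c - 2 * \<delta>) * N"
    using abs_s by (simp add: m_def \<rho>_eq algebra_simps)
  moreover have Dpos: "(c - 2 * \<delta>) * N > 0" using \<delta> N by simp
  ultimately have "top_eig \<le> m + s + p / (m + s - \<rho>)" by (intro top_eig_le) simp
  also have "p / (m + s - \<rho>) \<le> p / ((c - 2 * \<delta>) * N)"
    using p_nonneg D Dpos by (intro divide_left_mono mult_pos_pos[OF order_less_le_trans[OF Dpos D] Dpos])
  also have "\<dots> = h / (c - 2 * \<delta>)" using N by (simp add: p)
  also have "\<dots> \<le> (\<kappa> + \<delta>) / (c - 2 * \<delta>)" using hu \<delta> by (intro divide_right_mono) auto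
  finally show "top_eig - m - s - \<kappa> / c \<le> (\<kappa> + \<delta>) / (c - 2 * \<delta>) - \<kappa> / c" by simp
  have "p / m \<ge> (\<kappa> - \<delta> - \<delta>\<^sup>2) / c"
    using hl c N by (simp add: p m_def divide_right_mono)
  then have 1: "p / m - \<kappa> / c \<ge> - ((\<delta> + \<delta>\<^sup>2) / c)"
    by (simp add: diff_divide_distrib add_divide_distrib)
  have 2: "\<rho> * p / m\<^sup>2 \<le> \<delta> * (\<kappa> + \<delta>) / c\<^sup>2"
  proof -
    have "\<rho> * p / m\<^sup>2 = \<delta> * h / c\<^sup>2" using N by (simp add: \<rho>_eq p m_def power2_eq_square)
    also have "\<dots> \<le> \<delta> * (\<kappa> + \<delta>) / c\<^sup>2" using hu \<delta> by (intro divide_right_mono mult_left_mono) auto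
    finally show ?thesis .
  qed
  have 3: "\<bar>s\<bar> * p / m\<^sup>2 \<le> \<delta> * (\<kappa> + \<delta>) / c\<^sup>2"
    using 2 abs_s mult_right_mono[OF abs_s p_nonneg] divide_right_mono[of "\<bar>s\<bar> * p" "\<delta> * N * p" "m\<^sup>2"]
    by (simp add: \<rho>_eq)
  have 4: "p\<^sup>2 / m ^ 3 \<le> \<delta> * (\<kappa> + \<delta>)\<^sup>2 / c ^ 3"
  proof -
    have "p\<^sup>2 / m ^ 3 = (1 / N) * h\<^sup>2 / c ^ 3" using N by (simp add: p m_def power2_eq_square power3_eq_cube)
    also have "\<dots> \<le> \<delta> * (\<kappa> + \<delta>)\<^sup>2 / c ^ 3"
      using hu h0 \<delta> N\<delta> c by (intro divide_right_mono mult_mono power_mono) auto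
    finally show ?thesis .
  qed
  show "top_eig - m - s - \<kappa> / c \<ge>
      - ((\<delta> + \<delta>\<^sup>2) / c + 2 * \<delta> * (\<kappa> + \<delta>) / c\<^sup>2 + \<delta> * (\<kappa> + \<delta>)\<^sup>2 / c ^ 3)"
    using top_eig_ge 1 2 3 4 by simp
qed

end

text \<open>Both errors are continuous in \<delta> near 0 and vanish there.\<close>

lemma perturbation_error_small:
  fixes \<kappa> c \<epsilon> :: real
  assumes "c > 0" "\<epsilon> > 0"
  obtains \<delta> where "\<delta> > 0" "2 * \<delta> < c" "(\<kappa> + \<delta>) / (c - 2 * \<delta>) - \<kappa> / c < \<epsilon>"
    "(\<delta> + \<delta>\<^sup>2) / c + 2 * \<delta> * (\<kappa> + \<delta>) / c\<^sup>2 + \<delta> * (\<kappa> + \<delta>)\<^sup>2 / c ^ 3 < \<epsilon>"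
proof -
  have "((\<lambda>\<delta>. (\<kappa> + \<delta>) / (c - 2 * \<delta>) - \<kappa> / c) \<longlongrightarrow> (\<kappa> + 0) / (c - 2 * 0) - \<kappa> / c) (at_right 0)"
    using assms by (intro tendsto_intros) auto
  then have 1: "\<forall>\<^sub>F \<delta> in at_right 0. (\<kappa> + \<delta>) / (c - 2 * \<delta>) - \<kappa> / c < \<epsilon>"
    using assms by (intro order_tendstoD) auto
  have "((\<lambda>\<delta>. (\<delta> + \<delta>\<^sup>2) / c + 2 * \<delta> * (\<kappa> + \<delta>) / c\<^sup>2 + \<delta> * (\<kappa> + \<delta>)\<^sup>2 / c ^ 3) \<longlongrightarrow>
      (0 + 0\<^sup>2) / c + 2 * 0 * (\<kappa> + 0) / c\<^sup>2 + 0 * (\<kappa> + 0)\<^sup>2 / c ^ 3) (at_right 0)"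
    using assms by (intro tendsto_intros) auto
  then have 2: "\<forall>\<^sub>F \<delta> in at_right 0.
      (\<delta> + \<delta>\<^sup>2) / c + 2 * \<delta> * (\<kappa> + \<delta>) / c\<^sup>2 + \<delta> * (\<kappa> + \<delta>)\<^sup>2 / c ^ 3 < \<epsilon>"
    using assms by (intro order_tendstoD) auto
  have 3: "\<forall>\<^sub>F \<delta> in at_right 0. \<delta> > 0 \<and> 2 * \<delta> < c"
    using assms by (intro eventually_at_rightI[of 0 "c / 2"]) auto
  have "\<forall>\<^sub>F \<delta> in at_right 0. (\<delta> > 0 \<and> 2 * \<delta> < c) \<and> (\<kappa> + \<delta>) / (c - 2 * \<delta>) - \<kappa> / c < \<epsilon> \<and>
      (\<delta> + \<delta>\<^sup>2) / c + 2 * \<delta> * (\<kappa> + \<delta>) / c\<^sup>2 + \<delta> * (\<kappa> + \<delta>)\<^sup>2 / c ^ 3 < \<epsilon>"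
    using 1 2 3 by eventually_elim auto
  then show ?thesis using eventually_happens'[OF trivial_limit_at_right_real] that by blast
qed

section \<open>Moments of Gaussian families\<close>

text \<open>The degenerate law is a separate case because it has no density; without it the class
  would not be closed under linear combinations.\<close>

definition centered_gaussian :: "'a measure \<Rightarrow> ('a \<Rightarrow> real) \<Rightarrow> bool" where
  "centered_gaussian M L \<longleftrightarrow> L \<in> borel_measurable M \<and>
     ((AE \<omega> in M. L \<omega> = 0) \<or> (\<exists>\<sigma>>0. distributed M lborel L (normal_density 0 \<sigma>)))"

lemma (in prob_space) gaussian_rv_integrable:
  assumes "gaussian_rv M Y"
  shows "integrable M Y"
  using assms unfolding gaussian_rv_def
proof (elim conjE disjE exE)
  fix c assume [measurable]: "Y \<in> borel_measurable M" and "AE \<omega> in M. Y \<omega> = c"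
  then show ?thesis by (subst integrable_cong_AE[where g = "\<lambda>_. c"]) auto
next
  fix \<mu> \<sigma> :: real assume "\<sigma> > 0" "distributed M lborel Y (normal_density \<mu> \<sigma>)"
  then show ?thesis
    using distributed_integrable[of M lborel Y "normal_density \<mu> \<sigma>" "\<lambda>x. x"]
      integrable_normal_moment_nz_1[of \<sigma> \<mu>] by simp
qed

lemma (in prob_space) gaussian_rv_centered:
  assumes "gaussian_rv M Y"
  shows "centered_gaussian M (\<lambda>\<omega>. Y \<omega> - expectation Y)"
  using assms unfolding gaussian_rv_def
proof (elim conjE disjE exE)
  fix c assume [measurable]: "Y \<in> borel_measurable M" and Y: "AE \<omega> in M. Y \<omega> = c"
  then have "expectation Y = expectation (\<lambda>_. c)" by (intro integral_cong_AE) auto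
  then show ?thesis using Y by (simp add: centered_gaussian_def prob_space)
next
  fix \<mu> \<sigma> :: real
  assume [measurable]: "Y \<in> borel_measurable M"
    and Y: "\<sigma> > 0" "distributed M lborel Y (normal_density \<mu> \<sigma>)"
  have "expectation Y = \<mu>" using normal_distributed_expectation[OF Y] .
  moreover have "distributed M lborel (\<lambda>\<omega>. - \<mu> + 1 * Y \<omega>) (normal_density (- \<mu> + 1 * \<mu>) (\<bar>1\<bar> * \<sigma>))"
    using Y by (intro normal_density_affine) auto
  ultimately show ?thesis using Y by (auto simp: centered_gaussian_def)
qed

text \<open>The fourth-moment identity is the Gaussian input of Wick's formula. Written with the
  second moment instead of \<sigma>, it also covers the degenerate law.\<close>

lemma (in prob_space) centered_gaussian_moments:
  assumes "centered_gaussian M L"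
  shows "integrable M (\<lambda>\<omega>. (L \<omega>) ^ k)" and "expectation (\<lambda>\<omega>. (L \<omega>) ^ 4) = 3 * (expectation (\<lambda>\<omega>. (L \<omega>)\<^sup>2))\<^sup>2"
proof -
  have [measurable]: "L \<in> borel_measurable M" using assms by (simp add: centered_gaussian_def)
  consider "AE \<omega> in M. L \<omega> = 0" | \<sigma> where "\<sigma> > 0" "distributed M lborel L (normal_density 0 \<sigma>)"
    using assms by (auto simp: centered_gaussian_def)
  then have "integrable M (\<lambda>\<omega>. (L \<omega>) ^ k) \<and> expectation (\<lambda>\<omega>. (L \<omega>) ^ 4) = 3 * (expectation (\<lambda>\<omega>. (L \<omega>)\<^sup>2))\<^sup>2"
  proof cases
    case 1
    have "integrable M (\<lambda>\<omega>. (L \<omega>) ^ k) \<longleftrightarrow> integrable M (\<lambda>\<omega>. 0 ^ k :: real)"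
      using 1 by (intro integrable_cong_AE) auto
    moreover have "expectation (\<lambda>\<omega>. (L \<omega>) ^ j) = 0" if "j > 0" for j
      using 1 that by (intro integral_eq_zero_AE) auto
    ultimately show ?thesis by simp
  next
    case (2 \<sigma>)
    have "integrable M (\<lambda>\<omega>. (L \<omega>) ^ k)"
      using distributed_integrable[OF 2(2), of "\<lambda>x. x ^ k"] integrable_normal_moment[OF 2(1), of 0 k] by simp
    moreover have "expectation (\<lambda>\<omega>. (L \<omega>) ^ (2 * j)) = fact (2 * j) / ((2 / \<sigma>\<^sup>2) ^ j * fact j)" for j
      using distributed_integral[OF 2(2), of "\<lambda>x. x ^ (2 * j)"] integral_normal_moment_even[OF 2(1), of 0 j] by simp
    from this[of 1] this[of 2]
    have "expectation (\<lambda>\<omega>. (L \<omega>)\<^sup>2) = \<sigma>\<^sup>2" "expectation (\<lambda>\<omega>. (L \<omega>) ^ 4) = 3 * \<sigma> ^ 4"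
      by (simp_all add: fact_numeral power2_eq_square power4_eq_xxxx)
    ultimately show ?thesis by (simp add: flip: power_mult)
  qed
  then show "integrable M (\<lambda>\<omega>. (L \<omega>) ^ k)" "expectation (\<lambda>\<omega>. (L \<omega>) ^ 4) = 3 * (expectation (\<lambda>\<omega>. (L \<omega>)\<^sup>2))\<^sup>2"
    by blast+
qed

text \<open>Both sides of Wick's formula for four factors are symmetric and 4-linear, so by polarization it
  follows from its diagonal case \<open>E L\<^sup>4 = 3 (E L\<^sup>2)\<^sup>2\<close>.\<close>
lemma polarization4:
  fixes a b c d :: real
  defines "L \<equiv> \<lambda>x y z. a + (x * b + (y * c + z * d))"
  shows "192 * (a * b * c * d) = (L 1 1 1) ^ 4 - (L 1 1 (-1)) ^ 4 - (L 1 (-1) 1) ^ 4 - (L (-1) 1 1) ^ 4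
    + (L 1 (-1) (-1)) ^ 4 + (L (-1) 1 (-1)) ^ 4 + (L (-1) (-1) 1) ^ 4 - (L (-1) (-1) (-1)) ^ 4"
  unfolding L_def by Groebner_Basis.algebra

text \<open>For signs x, y, z, \<open>Q\<close> is the variance of a + x b + y c + z d, with
  \<open>s\<close> the sum of the four single variances. The constants match
  \<open>polarization4\<close>: 64 times the Gaussian factor 3 is 192.\<close>

lemma polarization4_quadratic:
  fixes s ab ac ad bc bd cd :: real
  defines "Q \<equiv> \<lambda>x y z. s + 2 * (x * ab + y * ac + z * ad + x * y * bc + x * z * bd + y * z * cd)"
  shows "64 * (ab * cd + ac * bd + ad * bc) = (Q 1 1 1)\<^sup>2 - (Q 1 1 (-1))\<^sup>2 - (Q 1 (-1) 1)\<^sup>2 - (Q (-1) 1 1)\<^sup>2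
    + (Q 1 (-1) (-1))\<^sup>2 + (Q (-1) 1 (-1))\<^sup>2 + (Q (-1) (-1) 1)\<^sup>2 - (Q (-1) (-1) (-1))\<^sup>2"
  unfolding Q_def by Groebner_Basis.algebra

text \<open>Joint Gaussianity in Cramer-Wold form. Only laws of linear combinations are given, so
  mixed moments have to be reached by polarization.\<close>

locale gaussian_family = prob_space M for M :: "'a measure" +
  fixes X :: "'i \<Rightarrow> 'a \<Rightarrow> real"
  assumes gaussian: "finite S \<Longrightarrow> centered_gaussian M (\<lambda>\<omega>. \<Sum>p\<in>S. c p * X p \<omega>)"
begin

text \<open>The linear span of the family. Matrix entries, row sums and the linear statistic all lie
  in it, so one Wick formula serves them all.\<close>

definition G :: "('a \<Rightarrow> real) set" where
  "G = {L. \<exists>S c. finite S \<and> L = (\<lambda>\<omega>. \<Sum>p\<in>S. c p * X p \<omega>)}"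

lemma G_gaussian: "L \<in> G \<Longrightarrow> centered_gaussian M L"
  using gaussian by (auto simp: G_def)

lemma G_measurable: "L \<in> G \<Longrightarrow> L \<in> borel_measurable M"
  using G_gaussian by (auto simp: centered_gaussian_def)

lemma G_X: "X p \<in> G"
  unfolding G_def by (intro CollectI exI[of _ "{p}"] exI[of _ "\<lambda>_. 1"]) simp

lemma G_zero: "(\<lambda>\<omega>. 0) \<in> G"
  unfolding G_def by (intro CollectI exI[of _ "{}"]) simp

lemma G_scale:
  assumes "a \<in> G" shows "(\<lambda>\<omega>. k * a \<omega>) \<in> G"
proof -
  obtain S c where S: "finite S" "a = (\<lambda>\<omega>. \<Sum>p\<in>S. c p * X p \<omega>)"
    using assms by (auto simp: G_def)
  then show ?thesis unfolding G_def
    by (intro CollectI exI[of _ S] exI[of _ "\<lambda>p. k * c p"]) (simp add: sum_distrib_left mult_ac)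
qed

lemma G_add:
  assumes "a \<in> G" "b \<in> G" shows "(\<lambda>\<omega>. a \<omega> + b \<omega>) \<in> G"
proof -
  obtain S c where S: "finite S" "a = (\<lambda>\<omega>. \<Sum>p\<in>S. c p * X p \<omega>)"
    using assms by (auto simp: G_def)
  obtain T d where T: "finite T" "b = (\<lambda>\<omega>. \<Sum>p\<in>T. d p * X p \<omega>)"
    using assms by (auto simp: G_def)
  define e where "e p = (if p \<in> S then c p else 0) + (if p \<in> T then d p else 0)" for p
  have "(\<Sum>p\<in>S \<union> T. e p * X p \<omega>) = a \<omega> + b \<omega>" for \<omega>
  proof -
    have "(\<Sum>p\<in>S \<union> T. (if p \<in> S then c p else 0) * X p \<omega>) = a \<omega>"
      unfolding S(2) using S T by (intro sum.mono_neutral_cong_right) auto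
    moreover have "(\<Sum>p\<in>S \<union> T. (if p \<in> T then d p else 0) * X p \<omega>) = b \<omega>"
      unfolding T(2) using S T by (intro sum.mono_neutral_cong_right) auto
    ultimately show ?thesis unfolding e_def by (simp only: distrib_right sum.distrib)
  qed
  then show ?thesis unfolding G_def using S T
    by (intro CollectI exI[of _ "S \<union> T"] exI[of _ e]) auto
qed

lemma G_sum: "(\<And>i. i \<in> I \<Longrightarrow> f i \<in> G) \<Longrightarrow> (\<lambda>\<omega>. \<Sum>i\<in>I. f i \<omega>) \<in> G"
  by (induction I rule: infinite_finite_induct) (auto intro: G_zero G_add)

lemma integrable_prod2:
  assumes "a \<in> G" "b \<in> G" shows "integrable M (\<lambda>\<omega>. a \<omega> * b \<omega>)"
proof -
  have "integrable M (\<lambda>\<omega>. (a \<omega> + b \<omega>)\<^sup>2)" "integrable M (\<lambda>\<omega>. (a \<omega> + (-1) * b \<omega>)\<^sup>2)"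
    by (intro centered_gaussian_moments(1) G_gaussian G_add G_scale assms)+
  then have "integrable M (\<lambda>\<omega>. 1 / 4 * ((a \<omega> + b \<omega>)\<^sup>2 - (a \<omega> + (-1) * b \<omega>)\<^sup>2))"
    by (intro integrable_mult_right Bochner_Integration.integrable_diff)
  then show ?thesis by (simp add: power2_eq_square algebra_simps)
qed

text \<open>A covariance, since members of \<open>G\<close> are centred.\<close>

definition C :: "('a \<Rightarrow> real) \<Rightarrow> ('a \<Rightarrow> real) \<Rightarrow> real" where
  "C a b = expectation (\<lambda>\<omega>. a \<omega> * b \<omega>)"

lemma C_commute: "C a b = C b a" by (simp add: C_def mult.commute)

lemma C_add: "a \<in> G \<Longrightarrow> b \<in> G \<Longrightarrow> c \<in> G \<Longrightarrow> C (\<lambda>\<omega>. a \<omega> + b \<omega>) c = C a c + C b c"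
  by (simp add: C_def distrib_right integrable_prod2)

lemma C_add_right: "a \<in> G \<Longrightarrow> b \<in> G \<Longrightarrow> c \<in> G \<Longrightarrow> C c (\<lambda>\<omega>. a \<omega> + b \<omega>) = C c a + C c b"
  by (simp add: C_def distrib_left integrable_prod2)

lemma C_scale: "C (\<lambda>\<omega>. k * a \<omega>) c = k * C a c"
  by (simp add: C_def mult.assoc)

lemma C_scale_right: "C c (\<lambda>\<omega>. k * a \<omega>) = k * C c a"
  by (simp add: C_def mult.left_commute)

lemma C_sum:
  assumes "\<And>i. i \<in> I \<Longrightarrow> f i \<in> G" "c \<in> G"
  shows "C (\<lambda>\<omega>. \<Sum>i\<in>I. f i \<omega>) c = (\<Sum>i\<in>I. C (f i) c)"
  unfolding C_def sum_distrib_right using assms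
  by (intro Bochner_Integration.integral_sum integrable_prod2)

lemma C_sum_right:
  assumes "\<And>i. i \<in> I \<Longrightarrow> f i \<in> G" "c \<in> G"
  shows "C c (\<lambda>\<omega>. \<Sum>i\<in>I. f i \<omega>) = (\<Sum>i\<in>I. C c (f i))"
  using C_sum[OF assms] by (simp add: C_commute)

lemma C_self: "C a a = expectation (\<lambda>\<omega>. (a \<omega>)\<^sup>2)"
  by (simp add: C_def power2_eq_square)

lemma expectation_power4: "a \<in> G \<Longrightarrow> expectation (\<lambda>\<omega>. (a \<omega>) ^ 4) = 3 * (C a a)\<^sup>2"
  using centered_gaussian_moments(2)[OF G_gaussian] by (simp add: C_self)

lemma wick4:
  assumes [simp]: "a \<in> G" "b \<in> G" "c \<in> G" "d \<in> G"
  shows "integrable M (\<lambda>\<omega>. a \<omega> * b \<omega> * c \<omega> * d \<omega>)"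
    and "expectation (\<lambda>\<omega>. a \<omega> * b \<omega> * c \<omega> * d \<omega>) = C a b * C c d + C a c * C b d + C a d * C b c"
proof -
  define L where "L x y z \<omega> = a \<omega> + (x * b \<omega> + (y * c \<omega> + z * d \<omega>))" for x y z \<omega>
  have L[simp]: "L x y z \<in> G" for x y z
    unfolding L_def[abs_def] by (intro G_add G_scale assms)
  have i4: "integrable M (\<lambda>\<omega>. (L x y z \<omega>) ^ 4)" for x y z
    by (intro centered_gaussian_moments(1) G_gaussian L)
  have CL: "C (L x y z) (L x y z) = C a a + x\<^sup>2 * C b b + y\<^sup>2 * C c c + z\<^sup>2 * C d d
      + 2 * (x * C a b + y * C a c + z * C a d + x * y * C b c + x * z * C b d + y * z * C c d)" for x y z
    unfolding L_def[abs_def]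
    by (simp add: C_add C_add_right C_scale C_scale_right G_add G_scale C_commute[of b a] C_commute[of c a]
        C_commute[of d a] C_commute[of c b] C_commute[of d b] C_commute[of d c]) Groebner_Basis.algebra
  have scale: "u = 1 / 192 * v" if "192 * u = v" for u v :: real
    using that by simp
  have polar: "a \<omega> * b \<omega> * c \<omega> * d \<omega> = 1 / 192 * (
      (L 1 1 1 \<omega>) ^ 4 - (L 1 1 (-1) \<omega>) ^ 4 - (L 1 (-1) 1 \<omega>) ^ 4 - (L (-1) 1 1 \<omega>) ^ 4
      + (L 1 (-1) (-1) \<omega>) ^ 4 + (L (-1) 1 (-1) \<omega>) ^ 4 + (L (-1) (-1) 1 \<omega>) ^ 4
      - (L (-1) (-1) (-1) \<omega>) ^ 4)" for \<omega>
    unfolding L_def by (rule scale, rule polarization4)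
  show "integrable M (\<lambda>\<omega>. a \<omega> * b \<omega> * c \<omega> * d \<omega>)"
    unfolding polar by (intro integrable_mult_right Bochner_Integration.integrable_diff
        Bochner_Integration.integrable_add i4)
  have "expectation (\<lambda>\<omega>. a \<omega> * b \<omega> * c \<omega> * d \<omega>) = 1 / 192 * (
      3 * (C (L 1 1 1) (L 1 1 1))\<^sup>2 - 3 * (C (L 1 1 (-1)) (L 1 1 (-1)))\<^sup>2
      - 3 * (C (L 1 (-1) 1) (L 1 (-1) 1))\<^sup>2 - 3 * (C (L (-1) 1 1) (L (-1) 1 1))\<^sup>2
      + 3 * (C (L 1 (-1) (-1)) (L 1 (-1) (-1)))\<^sup>2 + 3 * (C (L (-1) 1 (-1)) (L (-1) 1 (-1)))\<^sup>2
      + 3 * (C (L (-1) (-1) 1) (L (-1) (-1) 1))\<^sup>2 - 3 * (C (L (-1) (-1) (-1)) (L (-1) (-1) (-1)))\<^sup>2)"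
    unfolding polar expectation_power4[OF L, symmetric] by (simp add: i4)
  also have "\<dots> = C a b * C c d + C a c * C b d + C a d * C b c"
  proof -
    define Q where "Q x y z = (C a a + C b b + C c c + C d d) +
      2 * (x * C a b + y * C a c + z * C a d + x * y * C b c + x * z * C b d + y * z * C c d)" for x y z
    \<comment> \<open>Only signs are inserted, so the squares in \<open>CL\<close> are 1 and the
      single variances merge into one constant.\<close>
    have "C (L x y z) (L x y z) = Q x y z" if "x\<^sup>2 = 1" "y\<^sup>2 = 1" "z\<^sup>2 = 1" for x y z
      unfolding CL Q_def using that by simp
    then show ?thesis
      using polarization4_quadratic[of "C a b" "C c d" "C a c" "C b d" "C a d" "C b c"
        "C a a + C b b + C c c + C d d"] unfolding Q_def[symmetric] by simp
  qed
  finally show "expectation (\<lambda>\<omega>. a \<omega> * b \<omega> * c \<omega> * d \<omega>) = C a b * C c d + C a c * C b d + C a d * C b c" .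
qed

end

section \<open>Window averages\<close>

text \<open>Grouping the pairs by their difference \<open>d\<close> turns the double sum into the series of \<open>f\<close> with weights in
  \<open>[0, 1]\<close> that tend to \<open>1\<close>, so dominated convergence applies.\<close>
lemma window_average_tendsto:
  fixes f :: "'g::ab_group_add \<Rightarrow> real" and I :: "nat \<Rightarrow> 'b set" and \<phi> :: "'b \<Rightarrow> 'g"
  assumes f: "(\<lambda>d. \<bar>f d\<bar>) summable_on UNIV"
    and fin: "\<And>N. finite (I N)" and inj: "inj \<phi>"
    and w: "\<And>d. (\<lambda>N. real (card {x \<in> I N. \<phi> x + d \<in> \<phi> ` I N}) / real (card (I N))) \<longlonglongrightarrow> 1"
  shows "(\<lambda>N. (\<Sum>x\<in>I N. \<Sum>y\<in>I N. f (\<phi> y - \<phi> x)) / real (card (I N))) \<longlonglongrightarrow> (\<Sum>\<^sub>\<infinity>d. f d)"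
proof -
  \<comment> \<open>Series are read as integrals against counting measure, which makes dominated
    convergence available.\<close>
  let ?C = "count_space (UNIV :: 'g set)"
  have abs: "Infinite_Set_Sum.abs_summable_on f UNIV"
    using f by (simp flip: abs_summable_equivalent)
  then have int: "integrable ?C f" by (simp add: Infinite_Set_Sum.abs_summable_on_def)
  have inf: "integral\<^sup>L ?C f = (\<Sum>\<^sub>\<infinity>d. f d)"
    using infsetsum_infsum[OF abs] by (simp add: infsetsum_def)
  \<comment> \<open>The fraction of the window that stays inside it after translation by
    \<open>d\<close>.\<close>
  define v where "v N d = real (card {x \<in> I N. \<phi> x + d \<in> \<phi> ` I N}) / real (card (I N))" for N d
  have v_sum: "v N d = (\<Sum>x\<in>I N. of_bool (\<phi> x + d \<in> \<phi> ` I N)) / real (card (I N))" for N d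
    unfolding v_def using fin[of N] by (simp add: Int_def)
  have inner: "(\<Sum>y\<in>I N. f (\<phi> y - \<phi> x)) = integral\<^sup>L ?C (\<lambda>d. f d * of_bool (\<phi> x + d \<in> \<phi> ` I N))"
    and intx: "integrable ?C (\<lambda>d. f d * of_bool (\<phi> x + d \<in> \<phi> ` I N))" for N x
  proof -
    let ?S = "(\<lambda>y. \<phi> y - \<phi> x) ` I N"
    have S: "\<phi> x + d \<in> \<phi> ` I N \<longleftrightarrow> d \<in> ?S" for d
      by (auto simp: image_iff algebra_simps)
    have eq: "f d * of_bool (\<phi> x + d \<in> \<phi> ` I N) = indicator ?S d *\<^sub>R f d" for d
      unfolding S by (simp add: indicator_def)
    show "integrable ?C (\<lambda>d. f d * of_bool (\<phi> x + d \<in> \<phi> ` I N))"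
      unfolding eq by (intro integrable_mult_indicator int) simp
    have "inj_on (\<lambda>y. \<phi> y - \<phi> x) (I N)" using inj by (auto simp: inj_on_def)
    then have "(\<Sum>y\<in>I N. f (\<phi> y - \<phi> x)) = (\<Sum>d\<in>?S. f d)" by (simp add: sum.reindex)
    also have "\<dots> = infsetsum f ?S" using fin by simp
    also have "\<dots> = integral\<^sup>L ?C (\<lambda>d. indicator ?S d *\<^sub>R f d)"
      by (simp add: infsetsum_altdef set_lebesgue_integral_def)
    finally show "(\<Sum>y\<in>I N. f (\<phi> y - \<phi> x)) = integral\<^sup>L ?C (\<lambda>d. f d * of_bool (\<phi> x + d \<in> \<phi> ` I N))"
      unfolding eq .
  qed
  have eq: "(\<Sum>x\<in>I N. \<Sum>y\<in>I N. f (\<phi> y - \<phi> x)) / real (card (I N)) = integral\<^sup>L ?C (\<lambda>d. f d * v N d)" for N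
  proof -
    have "(\<lambda>d. f d * v N d) = (\<lambda>d. (\<Sum>x\<in>I N. f d * of_bool (\<phi> x + d \<in> \<phi> ` I N)) / real (card (I N)))"
      by (simp add: v_sum sum_distrib_left)
    then show ?thesis by (simp add: inner intx Bochner_Integration.integral_sum)
  qed
  have "(\<lambda>N. integral\<^sup>L ?C (\<lambda>d. f d * v N d)) \<longlonglongrightarrow> integral\<^sup>L ?C f"
  proof (rule integral_dominated_convergence[where w = "\<lambda>d. \<bar>f d\<bar>"])
    show "integrable ?C (\<lambda>d. \<bar>f d\<bar>)" using int by simp
    have "(\<lambda>N. f d * v N d) \<longlonglongrightarrow> f d * 1" for d
      using w[of d] unfolding v_def by (intro tendsto_intros)
    then show "AE d in ?C. (\<lambda>N. f d * v N d) \<longlonglongrightarrow> f d" by simp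
    have "0 \<le> v N d" "v N d \<le> 1" for N d
      using card_mono[OF fin[of N], of "{x \<in> I N. \<phi> x + d \<in> \<phi> ` I N}"]
      by (auto simp: v_def divide_le_eq_1)
    then show "AE d in ?C. norm (f d * v N d) \<le> \<bar>f d\<bar>" for N
      by (simp add: abs_mult mult_left_le)
  qed simp_all
  then show ?thesis by (simp add: eq inf)
qed

text \<open>Translation by \<open>d\<close> pushes at most |d| points out of the interval.\<close>

lemma interval_shift_density:
  "(\<lambda>N. real (card {i \<in> {..<N}. int i + d \<in> int ` {..<N}}) / real (card {..<N})) \<longlonglongrightarrow> 1"
proof (rule tendsto_sandwich[where f = "\<lambda>N. 1 - real_of_int \<bar>d\<bar> / real N" and h = "\<lambda>_. 1"])
  let ?S = "\<lambda>N. {i \<in> {..<N}. int i + d \<in> int ` {..<N}}"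
  show "\<forall>\<^sub>F N in sequentially. real (card (?S N)) / real (card {..<N}) \<le> 1"
  proof (intro always_eventually allI)
    fix N show "real (card (?S N)) / real (card {..<N}) \<le> 1"
      using card_mono[of "{..<N}" "?S N"] by (auto simp: divide_le_eq_1)
  qed
  have le: "N - nat \<bar>d\<bar> \<le> card (?S N)" for N
  proof -
    \<comment> \<open>One of \<open>nat (- d)\<close> and \<open>nat d\<close> is 0, so this
      interval has N - |d| points, truncated at 0.\<close>
    have "{nat (- d)..<N - nat d} \<subseteq> ?S N"
    proof
      fix i assume i: "i \<in> {nat (- d)..<N - nat d}"
      then have "int i + d = int (nat (int i + d))" "nat (int i + d) \<in> {..<N}" by auto
      then have "int i + d \<in> int ` {..<N}" by (rule image_eqI)
      with i show "i \<in> ?S N" by auto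
    qed
    from card_mono[OF _ this] show ?thesis by (auto split: if_splits)
  qed
  show "\<forall>\<^sub>F N in sequentially. 1 - real_of_int \<bar>d\<bar> / real N \<le> real (card (?S N)) / real (card {..<N})"
    using eventually_gt_at_top[of 0]
  proof eventually_elim
    case (elim N)
    have "real N - real_of_int \<bar>d\<bar> \<le> real (N - nat \<bar>d\<bar>)" by linarith
    also have "\<dots> \<le> real (card (?S N))" using le by simp
    finally have "(real N - real_of_int \<bar>d\<bar>) / real N \<le> real (card (?S N)) / real N"
      by (intro divide_right_mono) auto
    then show ?case using elim by (simp add: diff_divide_distrib)
  qed
  have "(\<lambda>N. 1 - real_of_int \<bar>d\<bar> / real N) \<longlonglongrightarrow> 1 - 0"
    by (intro tendsto_intros lim_const_over_n)
  then show "(\<lambda>N. 1 - real_of_int \<bar>d\<bar> / real N) \<longlonglongrightarrow> 1" by simp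
qed simp

lemma window_average_1d:
  fixes f :: "int \<Rightarrow> real"
  assumes "(\<lambda>d. \<bar>f d\<bar>) summable_on UNIV"
  shows "(\<lambda>N. (\<Sum>i<N. \<Sum>k<N. f (int k - int i)) / real N) \<longlonglongrightarrow> (\<Sum>\<^sub>\<infinity>d. f d)"
  using window_average_tendsto[OF assms, of lessThan int, OF _ _ interval_shift_density] by simp

text \<open>The overlap of a square with its translate is a product, so its density is the product
  of two one-dimensional ones.\<close>

lemma window_average_2d:
  fixes f :: "int \<Rightarrow> int \<Rightarrow> real"
  assumes "(\<lambda>(i, j). \<bar>f i j\<bar>) summable_on UNIV"
  shows "(\<lambda>N. (\<Sum>i<N. \<Sum>j<N. \<Sum>k<N. \<Sum>l<N. f (int k - int i) (int l - int j)) / (real N)\<^sup>2)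
     \<longlonglongrightarrow> (\<Sum>\<^sub>\<infinity>(i, j). f i j)"
proof -
  let ?I = "\<lambda>N::nat. {..<N} \<times> {..<N}"
  let ?\<phi> = "\<lambda>p. (int (fst p), int (snd p))"
  let ?S = "\<lambda>N d. {i \<in> {..<N}. int i + d \<in> int ` {..<N}}"
  have w: "(\<lambda>N. real (card {x \<in> ?I N. ?\<phi> x + d \<in> ?\<phi> ` ?I N}) / real (card (?I N))) \<longlonglongrightarrow> 1" for d
  proof -
    have im: "?\<phi> ` ?I N = int ` {..<N} \<times> int ` {..<N}" for N by force
    have "{x \<in> ?I N. ?\<phi> x + d \<in> ?\<phi> ` ?I N} = ?S N (fst d) \<times> ?S N (snd d)" for N
      unfolding im by (cases d) auto
    then have eq: "real (card {x \<in> ?I N. ?\<phi> x + d \<in> ?\<phi> ` ?I N}) / real (card (?I N))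
      = (real (card (?S N (fst d))) / real (card {..<N})) * (real (card (?S N (snd d))) / real (card {..<N}))" for N
      by (simp add: card_cartesian_product)
    show ?thesis unfolding eq
      using tendsto_mult[OF interval_shift_density[of "fst d"] interval_shift_density[of "snd d"]] by simp
  qed
  have s: "(\<lambda>d. \<bar>f (fst d) (snd d)\<bar>) summable_on UNIV" using assms by (simp add: case_prod_unfold)
  have inj: "inj ?\<phi>" by (auto simp: inj_def prod_eq_iff)
  show ?thesis
    using window_average_tendsto[OF s, of ?I ?\<phi>, OF _ inj w]
    by (simp add: case_prod_unfold card_cartesian_product power2_eq_square sum.cartesian_product')
qed

section \<open>Stationary Gaussian fields\<close>

text \<open>Stationarity enters only through covariances; \<open>stationary_gaussianI\<close>
  extracts them from the equality of laws.\<close>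

locale stationary_gaussian = gaussian_family M X
  for M :: "'a measure" and X :: "int \<times> int \<Rightarrow> 'a \<Rightarrow> real" +
  fixes R :: "int \<Rightarrow> int \<Rightarrow> real"
  assumes cov: "C (X (i, j)) (X (k, l)) = R (k - i) (l - j)"
    and abs_summable: "(\<lambda>(i, j). \<bar>R i j\<bar>) summable_on UNIV"
begin

definition B :: real where "B = (\<Sum>\<^sub>\<infinity>(i, j). \<bar>R i j\<bar>)"

text \<open>Injectivity makes the summands distinct terms of the series \<open>B\<close>, so the
  bound is uniform in the size of \<open>I\<close>.\<close>

lemma sum_abs_R_le:
  assumes "finite I" "inj_on (\<lambda>x. (f x, g x)) I"
  shows "(\<Sum>x\<in>I. \<bar>R (f x) (g x)\<bar>) \<le> B"
proof -
  have "(\<Sum>x\<in>I. \<bar>R (f x) (g x)\<bar>) = (\<Sum>(i, j)\<in>(\<lambda>x. (f x, g x)) ` I. \<bar>R i j\<bar>)"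
    using assms(2) by (simp add: sum.reindex)
  also have "\<dots> \<le> B"
    unfolding B_def using assms(1) by (intro finite_sum_le_infsum abs_summable) auto
  finally show ?thesis .
qed

lemma abs_R_le: "\<bar>R i j\<bar> \<le> B"
  using sum_abs_R_le[of "{()}" "\<lambda>_. i" "\<lambda>_. j"] by simp

lemma B_nonneg: "B \<ge> 0" using abs_R_le[of 0 0] by linarith

definition W :: "nat \<Rightarrow> nat \<Rightarrow> 'a \<Rightarrow> real" where
  "W i j \<omega> = X (int i + 1, int j + 1) \<omega> + X (int j + 1, int i + 1) \<omega>"

lemma W_sym: "W i j \<omega> = W j i \<omega>" by (simp add: W_def)

lemma W_in_G: "W i j \<in> G"
  unfolding W_def[abs_def] by (intro G_add G_X)

definition K :: "nat \<Rightarrow> nat \<Rightarrow> nat \<Rightarrow> nat \<Rightarrow> real" where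
  "K i j k l = C (W i j) (W k l)"

lemma K_eq: "K i j k l = R (int k - int i) (int l - int j) + R (int l - int i) (int k - int j)
    + R (int k - int j) (int l - int i) + R (int l - int j) (int k - int i)"
  unfolding K_def W_def[abs_def] by (simp add: C_add C_add_right G_X G_add cov)

lemma abs_K_le_sum: "\<bar>K i j k l\<bar> \<le> \<bar>R (int k - int i) (int l - int j)\<bar> + \<bar>R (int l - int i) (int k - int j)\<bar>
    + \<bar>R (int k - int j) (int l - int i)\<bar> + \<bar>R (int l - int j) (int k - int i)\<bar>"
  unfolding K_eq by linarith

lemma abs_K_le: "\<bar>K i j k l\<bar> \<le> 4 * B"
  using abs_K_le_sum[of i j k l] abs_R_le[of "int k - int i" "int l - int j"]
    abs_R_le[of "int l - int i" "int k - int j"] abs_R_le[of "int k - int j" "int l - int i"]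
    abs_R_le[of "int l - int j" "int k - int i"] by linarith

text \<open>The source of the power counting: summing a covariance over indices that determine its
  second pair injectively costs a constant and no power of \<open>N\<close>.\<close>

lemma sum_abs_K_le:
  assumes I: "finite I" and inj: "inj_on (\<lambda>x. (f x, g x)) I"
  shows "(\<Sum>x\<in>I. \<bar>K i j (f x) (g x)\<bar>) \<le> 4 * B"
proof -
  have "(\<Sum>x\<in>I. \<bar>K i j (f x) (g x)\<bar>) \<le> (\<Sum>x\<in>I. \<bar>R (int (f x) - int i) (int (g x) - int j)\<bar>
      + \<bar>R (int (g x) - int i) (int (f x) - int j)\<bar>
      + \<bar>R (int (f x) - int j) (int (g x) - int i)\<bar> + \<bar>R (int (g x) - int j) (int (f x) - int i)\<bar>)"
    by (intro sum_mono abs_K_le_sum)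
  also have "\<dots> \<le> B + B + B + B"
    unfolding sum.distrib using inj
    by (intro add_mono sum_abs_R_le I) (auto simp: inj_on_def)
  finally show ?thesis by simp
qed

text \<open>Each of the three Wick pairings is a product of two covariances. One is bounded by 4 B,
  the other absorbs the sum over one index at the cost of another 4 B, and the three remaining
  indices give N^3: in total 3 times (4 B)^2 N^3.\<close>

lemma expectation_trace4:
  shows "integrable M (\<lambda>\<omega>. \<Sum>i<N. \<Sum>k<N. (\<Sum>j<N. W i j \<omega> * W j k \<omega>)\<^sup>2)" (is "integrable M ?T")
    and "expectation (\<lambda>\<omega>. \<Sum>i<N. \<Sum>k<N. (\<Sum>j<N. W i j \<omega> * W j k \<omega>)\<^sup>2) \<le> 48 * B\<^sup>2 * real N ^ 3"
proof -
  have T: "?T = (\<lambda>\<omega>. \<Sum>i<N. \<Sum>k<N. \<Sum>j<N. \<Sum>l<N. W i j \<omega> * W j k \<omega> * W i l \<omega> * W l k \<omega>)"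
    by (simp add: power2_eq_square sum_product mult.assoc)
  note int = wick4(1)[OF W_in_G W_in_G W_in_G W_in_G]
  show "integrable M ?T" unfolding T by (intro Bochner_Integration.integrable_sum int)
  have "expectation ?T = (\<Sum>i<N. \<Sum>k<N. \<Sum>j<N. \<Sum>l<N.
      K i j j k * K i l l k + K i j i l * K j k l k + K i j l k * K j k i l)"
    unfolding T by (simp add: int wick4(2)[OF W_in_G W_in_G W_in_G W_in_G] K_def)
  also have "\<dots> \<le> (\<Sum>i<N. \<Sum>k<N. \<Sum>j<N. \<Sum>l<N.
      \<bar>K i j j k\<bar> * (4 * B) + \<bar>K i j i l\<bar> * (4 * B) + \<bar>K i j l k\<bar> * (4 * B))"
  proof (intro sum_mono add_mono)
    have "a * b \<le> \<bar>a\<bar> * (4 * B)" if "\<bar>b\<bar> \<le> 4 * B" for a b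
      using mult_left_mono[OF that, of "\<bar>a\<bar>"] abs_ge_self[of "a * b"] by (simp add: abs_mult)
    then show "K i j j k * K i l l k \<le> \<bar>K i j j k\<bar> * (4 * B)"
      "K i j i l * K j k l k \<le> \<bar>K i j i l\<bar> * (4 * B)"
      "K i j l k * K j k i l \<le> \<bar>K i j l k\<bar> * (4 * B)" for i j k l
      using abs_K_le by blast+
  qed
  also have "\<dots> = 4 * B * (real N * (\<Sum>i<N. \<Sum>j<N. \<Sum>k<N. \<bar>K i j j k\<bar>)
      + real N * (\<Sum>i<N. \<Sum>j<N. \<Sum>l<N. \<bar>K i j i l\<bar>) + (\<Sum>i<N. \<Sum>k<N. \<Sum>j<N. \<Sum>l<N. \<bar>K i j l k\<bar>))"
  proof -
    have "(\<Sum>i<N. \<Sum>k<N. \<Sum>j<N. \<bar>K i j j k\<bar>) = (\<Sum>i<N. \<Sum>j<N. \<Sum>k<N. \<bar>K i j j k\<bar>)"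
      by (intro sum.cong refl sum.swap)
    moreover have "(\<Sum>i<N. \<Sum>k<N. \<Sum>j<N. \<Sum>l<N. \<bar>K i j i l\<bar>) = real N * (\<Sum>i<N. \<Sum>j<N. \<Sum>l<N. \<bar>K i j i l\<bar>)"
      by (simp add: sum_distrib_left)
    moreover have "(\<Sum>i<N. \<Sum>k<N. \<Sum>j<N. \<Sum>l<N. \<bar>K i j j k\<bar>) = real N * (\<Sum>i<N. \<Sum>k<N. \<Sum>j<N. \<bar>K i j j k\<bar>)"
      by (simp add: sum_distrib_left)
    ultimately show ?thesis
      by (simp only: sum.distrib flip: sum_distrib_right) (simp add: algebra_simps)
  qed
  also have "\<dots> \<le> 4 * B * (real N * (\<Sum>i<N. \<Sum>j<N. 4 * B) + real N * (\<Sum>i<N. \<Sum>j<N. 4 * B)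
      + (\<Sum>i<N. \<Sum>k<N. \<Sum>j<N. 4 * B))"
    by (intro mult_left_mono add_mono sum_mono sum_abs_K_le)
      (use B_nonneg in \<open>auto simp: inj_on_def\<close>)
  also have "\<dots> = 48 * B\<^sup>2 * real N ^ 3" by (simp add: power2_eq_square power3_eq_cube)
  finally show "expectation ?T \<le> 48 * B\<^sup>2 * real N ^ 3" .
qed

section \<open>Row sums: mean and fluctuation of their normalised squared norm\<close>

definition V :: "nat \<Rightarrow> nat \<Rightarrow> 'a \<Rightarrow> real" where "V N i \<omega> = (\<Sum>j<N. W i j \<omega>)"

lemma V_in_G: "V N i \<in> G"
  unfolding V_def[abs_def] by (intro G_sum W_in_G)

lemma C_V: "C (V N i) (V N k) = (\<Sum>j<N. \<Sum>l<N. K i j k l)"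
proof -
  have "C (V N i) (V N k) = (\<Sum>j<N. C (W i j) (V N k))"
    by (subst (1) V_def[abs_def]) (intro C_sum W_in_G V_in_G)
  also have "\<dots> = (\<Sum>j<N. \<Sum>l<N. K i j k l)"
    unfolding V_def[abs_def] K_def by (intro sum.cong refl C_sum_right W_in_G)
  finally show ?thesis .
qed

text \<open>Largest entry times absolute row sum: both are at most 4 B N, and there are
  \<open>N\<close> rows.\<close>

lemma sum_C_V_squared_le: "(\<Sum>i<N. \<Sum>k<N. (C (V N i) (V N k))\<^sup>2) \<le> 16 * B\<^sup>2 * real N ^ 3"
proof -
  have abs_le: "\<bar>C (V N i) (V N k)\<bar> \<le> (\<Sum>j<N. \<Sum>l<N. \<bar>K i j k l\<bar>)" for i k
    unfolding C_V by (intro order_trans[OF sum_abs] sum_mono sum_abs)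
  have 1: "\<bar>C (V N i) (V N k)\<bar> \<le> real N * (4 * B)" for i k
  proof -
    have "(\<Sum>j<N. \<Sum>l<N. \<bar>K i j k l\<bar>) \<le> (\<Sum>j<N. 4 * B)"
      by (intro sum_mono sum_abs_K_le) (auto simp: inj_on_def)
    then show ?thesis using abs_le[of i k] by simp
  qed
  \<comment> \<open>Adding the sum over \<open>k\<close> costs no further power of \<open>N\<close>:
    (k, l) runs over distinct pairs, leaving only \<open>j\<close> to count.\<close>
  have 2: "(\<Sum>k<N. \<bar>C (V N i) (V N k)\<bar>) \<le> real N * (4 * B)" for i
  proof -
    have "(\<Sum>k<N. \<bar>C (V N i) (V N k)\<bar>) \<le> (\<Sum>k<N. \<Sum>j<N. \<Sum>l<N. \<bar>K i j k l\<bar>)"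
      by (intro sum_mono abs_le)
    also have "\<dots> = (\<Sum>j<N. \<Sum>k<N. \<Sum>l<N. \<bar>K i j k l\<bar>)" by (rule sum.swap)
    also have "\<dots> = (\<Sum>j<N. \<Sum>p\<in>{..<N}\<times>{..<N}. \<bar>K i j (fst p) (snd p)\<bar>)"
      by (simp add: sum.cartesian_product')
    also have "\<dots> \<le> (\<Sum>j<N. 4 * B)" by (intro sum_mono sum_abs_K_le) (auto simp: inj_on_def)
    finally show ?thesis by simp
  qed
  have "(\<Sum>i<N. \<Sum>k<N. (C (V N i) (V N k))\<^sup>2) \<le> (\<Sum>i<N. \<Sum>k<N. (real N * (4 * B)) * \<bar>C (V N i) (V N k)\<bar>)"
  proof (intro sum_mono)
    show "(C (V N i) (V N k))\<^sup>2 \<le> (real N * (4 * B)) * \<bar>C (V N i) (V N k)\<bar>" for i k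
      using mult_right_mono[OF 1[of i k], of "\<bar>C (V N i) (V N k)\<bar>"] by (simp add: power2_eq_square)
  qed
  also have "\<dots> = (\<Sum>i<N. (real N * (4 * B)) * (\<Sum>k<N. \<bar>C (V N i) (V N k)\<bar>))"
    by (simp add: sum_distrib_left)
  also have "\<dots> \<le> (\<Sum>i<N. (real N * (4 * B)) * (real N * (4 * B)))"
    using B_nonneg by (intro sum_mono mult_left_mono 2) auto
  also have "\<dots> = 16 * B\<^sup>2 * real N ^ 3" by (simp add: power2_eq_square power3_eq_cube)
  finally show ?thesis .
qed

definition Y :: "nat \<Rightarrow> 'a \<Rightarrow> real" where "Y N \<omega> = (\<Sum>i<N. (V N i \<omega>)\<^sup>2) / (real N)\<^sup>2"

text \<open>Squared bias plus variance about an arbitrary centre \<kappa>. By Wick the variance of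
  \<open>Y N\<close> is 2 / N^4 times the sum in \<open>sum_C_V_squared_le\<close>, hence of order 1
  / N.\<close>

lemma Y_second_moment:
  defines "e \<equiv> \<lambda>N. (\<Sum>i<N. C (V N i) (V N i)) / (real N)\<^sup>2"
  assumes N: "N > 0"
  shows "integrable M (\<lambda>\<omega>. (Y N \<omega> - \<kappa>)\<^sup>2)"
    and "expectation (\<lambda>\<omega>. (Y N \<omega> - \<kappa>)\<^sup>2) \<le> (e N - \<kappa>)\<^sup>2 + 32 * B\<^sup>2 / real N"
proof -
  let ?v = "\<lambda>i k. C (V N i) (V N k)"
  have i2: "integrable M (\<lambda>\<omega>. (V N i \<omega>)\<^sup>2)" for i
    using integrable_prod2[OF V_in_G V_in_G] by (simp add: power2_eq_square)
  have YY: "(\<lambda>\<omega>. (Y N \<omega>)\<^sup>2) = (\<lambda>\<omega>. (\<Sum>i<N. \<Sum>k<N. V N i \<omega> * V N i \<omega> * V N k \<omega> * V N k \<omega>) / (real N) ^ 4)"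
    by (simp add: Y_def power_divide power2_eq_square sum_product mult.assoc power4_eq_xxxx)
  note int = wick4(1)[OF V_in_G V_in_G V_in_G V_in_G]
  have iYY: "integrable M (\<lambda>\<omega>. (Y N \<omega>)\<^sup>2)"
    unfolding YY by (intro integrable_divide_zero Bochner_Integration.integrable_sum int)
  have iY: "integrable M (Y N)"
    unfolding Y_def[abs_def] by (intro integrable_divide_zero Bochner_Integration.integrable_sum i2)
  have EY: "expectation (Y N) = e N"
    unfolding Y_def[abs_def] e_def by (simp add: i2 C_self)
  have "expectation (\<lambda>\<omega>. (Y N \<omega>)\<^sup>2) = (\<Sum>i<N. \<Sum>k<N. ?v i i * ?v k k + 2 * (?v i k)\<^sup>2) / (real N) ^ 4"
    unfolding YY by (simp add: int wick4(2)[OF V_in_G V_in_G V_in_G V_in_G] power2_eq_square add.commute)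
  also have "\<dots> = (\<Sum>i<N. \<Sum>k<N. ?v i i * ?v k k) / (real N) ^ 4 + 2 * (\<Sum>i<N. \<Sum>k<N. (?v i k)\<^sup>2) / (real N) ^ 4"
    by (simp only: sum.distrib add_divide_distrib flip: sum_distrib_left)
  also have "(\<Sum>i<N. \<Sum>k<N. ?v i i * ?v k k) / (real N) ^ 4 = (e N)\<^sup>2"
    by (simp add: e_def power_divide power2_eq_square sum_product power4_eq_xxxx)
  also have "2 * (\<Sum>i<N. \<Sum>k<N. (?v i k)\<^sup>2) / (real N) ^ 4 \<le> 2 * (16 * B\<^sup>2 * real N ^ 3) / (real N) ^ 4"
    by (intro divide_right_mono mult_left_mono sum_C_V_squared_le) auto
  also have "\<dots> = 32 * B\<^sup>2 / real N" using N by (simp add: power3_eq_cube power4_eq_xxxx)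
  finally have EYY: "expectation (\<lambda>\<omega>. (Y N \<omega>)\<^sup>2) \<le> (e N)\<^sup>2 + 32 * B\<^sup>2 / real N" by simp
  have sq: "(\<lambda>\<omega>. (Y N \<omega> - \<kappa>)\<^sup>2) = (\<lambda>\<omega>. (Y N \<omega>)\<^sup>2 - 2 * \<kappa> * Y N \<omega> + \<kappa>\<^sup>2)"
    by (simp add: power2_eq_square algebra_simps)
  show "integrable M (\<lambda>\<omega>. (Y N \<omega> - \<kappa>)\<^sup>2)"
    unfolding sq using iYY iY by simp
  have "expectation (\<lambda>\<omega>. (Y N \<omega> - \<kappa>)\<^sup>2) = expectation (\<lambda>\<omega>. (Y N \<omega>)\<^sup>2) - 2 * \<kappa> * e N + \<kappa>\<^sup>2"
    unfolding sq using iYY iY by (simp add: EY prob_space)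
  also have "\<dots> \<le> (e N - \<kappa>)\<^sup>2 + 32 * B\<^sup>2 / real N"
    using EYY by (simp add: power2_eq_square algebra_simps)
  finally show "expectation (\<lambda>\<omega>. (Y N \<omega> - \<kappa>)\<^sup>2) \<le> (e N - \<kappa>)\<^sup>2 + 32 * B\<^sup>2 / real N" .
qed

lemma abs_summable_row: "(\<lambda>d. \<bar>R 0 d\<bar>) summable_on UNIV"
  and abs_summable_col: "(\<lambda>d. \<bar>R d 0\<bar>) summable_on UNIV"
proof -
  have "((\<lambda>(i, j). \<bar>R i j\<bar>) \<circ> (\<lambda>d. (0, d))) summable_on UNIV"
    using abs_summable by (intro summable_on_reindex[THEN iffD1] summable_on_subset_banach[OF abs_summable]) (auto simp: inj_def)
  then show "(\<lambda>d. \<bar>R 0 d\<bar>) summable_on UNIV" by (simp add: o_def)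
  have "((\<lambda>(i, j). \<bar>R i j\<bar>) \<circ> (\<lambda>d. (d, 0))) summable_on UNIV"
    using abs_summable by (intro summable_on_reindex[THEN iffD1] summable_on_subset_banach[OF abs_summable]) (auto simp: inj_def)
  then show "(\<lambda>d. \<bar>R d 0\<bar>) summable_on UNIV" by (simp add: o_def)
qed

definition \<kappa> :: real where "\<kappa> = (\<Sum>\<^sub>\<infinity>i. R i 0 + R 0 i)"

text \<open>In \<open>K i j i l\<close> the first and last terms of \<open>K_eq\<close> have one
  argument 0 and do not involve \<open>i\<close>; they yield one-dimensional window averages. The
  other two mix both coordinates: for fixed \<open>i\<close> they sum to at most 2 B in absolute
  value, which is lost after division by N^2.\<close>

lemma mean_Y_tendsto: "(\<lambda>N. (\<Sum>i<N. C (V N i) (V N i)) / (real N)\<^sup>2) \<longlonglongrightarrow> \<kappa>"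
proof -
  let ?r = "\<lambda>N. (\<Sum>j<N. \<Sum>l<N. R 0 (int l - int j)) / real N + (\<Sum>j<N. \<Sum>l<N. R (int l - int j) 0) / real N"
  let ?m = "\<lambda>N. \<Sum>i<N. \<Sum>j<N. \<Sum>l<N. R (int l - int i) (int i - int j) + R (int i - int j) (int l - int i)"
  have "?r \<longlonglongrightarrow> (\<Sum>\<^sub>\<infinity>d. R 0 d) + (\<Sum>\<^sub>\<infinity>d. R d 0)"
    by (intro tendsto_add window_average_1d abs_summable_row abs_summable_col)
  also have "(\<Sum>\<^sub>\<infinity>d. R 0 d) + (\<Sum>\<^sub>\<infinity>d. R d 0) = \<kappa>"
    unfolding \<kappa>_def using abs_summable_row abs_summable_col
    by (subst infsum_add) (auto intro: abs_summable_summable simp: add.commute)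
  finally have r: "?r \<longlonglongrightarrow> \<kappa>" .
  have m: "\<bar>?m N\<bar> \<le> real N * (2 * B)" for N
  proof -
    have "\<bar>?m N\<bar> \<le> (\<Sum>i<N. \<Sum>j<N. \<Sum>l<N. \<bar>R (int l - int i) (int i - int j)\<bar> + \<bar>R (int i - int j) (int l - int i)\<bar>)"
      by (intro order_trans[OF sum_abs] sum_mono abs_triangle_ineq)
    also have "\<dots> = (\<Sum>i<N. (\<Sum>p\<in>{..<N}\<times>{..<N}. \<bar>R (int (snd p) - int i) (int i - int (fst p))\<bar>)
        + (\<Sum>p\<in>{..<N}\<times>{..<N}. \<bar>R (int i - int (fst p)) (int (snd p) - int i)\<bar>))"
      by (simp add: sum.cartesian_product' sum.distrib)
    also have "\<dots> \<le> (\<Sum>i<N. B + B)"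
      by (intro sum_mono add_mono sum_abs_R_le) (auto simp: inj_on_def)
    finally show ?thesis by simp
  qed
  have "(\<lambda>N. ?m N / (real N)\<^sup>2) \<longlonglongrightarrow> 0"
  proof (rule Lim_null_comparison)
    show "(\<lambda>N. 2 * B / real N) \<longlonglongrightarrow> 0" by (rule lim_const_over_n)
    show "\<forall>\<^sub>F N in sequentially. norm (?m N / (real N)\<^sup>2) \<le> 2 * B / real N"
      using eventually_gt_at_top[of 0]
    proof eventually_elim
      case (elim N)
      have "\<bar>?m N\<bar> / (real N)\<^sup>2 \<le> real N * (2 * B) / (real N)\<^sup>2" by (intro divide_right_mono m) simp
      then show ?case using elim by (simp add: power2_eq_square)
    qed
  qed
  from tendsto_add[OF r this] have "(\<lambda>N. ?r N + ?m N / (real N)\<^sup>2) \<longlonglongrightarrow> \<kappa>" by simp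
  moreover have "\<forall>\<^sub>F N in sequentially. ?r N + ?m N / (real N)\<^sup>2 = (\<Sum>i<N. C (V N i) (V N i)) / (real N)\<^sup>2"
    using eventually_gt_at_top[of 0]
  proof eventually_elim
    case (elim N)
    have "(\<Sum>i<N. C (V N i) (V N i)) = (\<Sum>i<N. \<Sum>j<N. \<Sum>l<N. R 0 (int l - int j) + R (int l - int j) 0
        + (R (int l - int i) (int i - int j) + R (int i - int j) (int l - int i)))"
      unfolding C_V K_eq by (intro sum.cong refl) simp
    also have "\<dots> = real N * (\<Sum>j<N. \<Sum>l<N. R 0 (int l - int j)) + real N * (\<Sum>j<N. \<Sum>l<N. R (int l - int j) 0) + ?m N"
      by (simp only: sum.distrib) simp
    finally show ?case using elim by (simp add: add_divide_distrib power2_eq_square)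
  qed
  ultimately show ?thesis by (rule Lim_transform_eventually)
qed

text \<open>This is the \<open>s\<close> of the perturbation bounds, by \<open>S_eq_sum_V\<close>.
  Written in \<open>X\<close> instead of \<open>W\<close>, it has as variance four times a plain
  two-dimensional window average.\<close>

definition S :: "nat \<Rightarrow> 'a \<Rightarrow> real" where
  "S N \<omega> = (2 / real N) * (\<Sum>i<N. \<Sum>j<N. X (int i + 1, int j + 1) \<omega>)"

lemma S_eq_sum_V: "S N \<omega> = (\<Sum>i<N. V N i \<omega>) / real N"
proof -
  have "(\<Sum>i<N. \<Sum>j<N. X (int j + 1, int i + 1) \<omega>) = (\<Sum>i<N. \<Sum>j<N. X (int i + 1, int j + 1) \<omega>)"
    by (rule sum.swap)
  then show ?thesis by (simp add: S_def V_def W_def sum.distrib)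
qed

lemma S_in_G: "S N \<in> G"
  unfolding S_def[abs_def] by (intro G_scale G_sum G_X)

lemma C_S_tendsto: "(\<lambda>N. C (S N) (S N)) \<longlonglongrightarrow> 4 * (\<Sum>\<^sub>\<infinity>(i, j). R i j)"
proof -
  let ?X = "\<lambda>N \<omega>. \<Sum>i<N. \<Sum>j<N. X (int i + 1, int j + 1) \<omega>"
  have XG: "?X N \<in> G" for N by (intro G_sum G_X)
  have XG': "(\<lambda>\<omega>. \<Sum>j<N. X (int i + 1, int j + 1) \<omega>) \<in> G" for N i by (intro G_sum G_X)
  have "C (?X N) (?X N) = (\<Sum>i<N. \<Sum>j<N. \<Sum>k<N. \<Sum>l<N. R (int k - int i) (int l - int j))" for N
    by (simp add: C_sum C_sum_right XG XG' G_X cov)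
  then have "C (S N) (S N) = 4 * ((\<Sum>i<N. \<Sum>j<N. \<Sum>k<N. \<Sum>l<N. R (int k - int i) (int l - int j)) / (real N)\<^sup>2)" for N
    unfolding S_def[abs_def] C_scale C_scale_right by (simp add: power2_eq_square)
  then show ?thesis
    using tendsto_mult_left[OF window_average_2d[OF abs_summable], of 4] by simp
qed

end

section \<open>Weak convergence\<close>

text \<open>Expressing all normal laws by one function reduces a limit with varying variance to the
  continuity of that function.\<close>

lemma (in prob_space) normal_distributed_cdf:
  assumes \<sigma>: "\<sigma> > 0" and L: "distributed M lborel L (normal_density \<mu> \<sigma>)"
  shows "prob {\<omega> \<in> space M. L \<omega> \<le> x} = cdf std_normal_distribution ((x - \<mu>) / \<sigma>)"
proof -
  have D: "distributed M lborel (\<lambda>\<omega>. (L \<omega> - \<mu>) / \<sigma>) std_normal_density"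
    using L normal_standard_normal_convert[OF \<sigma>] by simp
  have [measurable]: "(\<lambda>\<omega>. (L \<omega> - \<mu>) / \<sigma>) \<in> borel_measurable M"
    using distributed_measurable[OF D] by simp
  have "cdf std_normal_distribution ((x - \<mu>) / \<sigma>)
      = measure (distr M lborel (\<lambda>\<omega>. (L \<omega> - \<mu>) / \<sigma>)) {..(x - \<mu>) / \<sigma>}"
    using distributed_distr_eq_density[OF D] by (simp add: cdf_def)
  also have "\<dots> = prob {\<omega> \<in> space M. (L \<omega> - \<mu>) / \<sigma> \<le> (x - \<mu>) / \<sigma>}"
    by (subst measure_distr) (auto intro!: arg_cong[where f = prob])
  also have "\<dots> = prob {\<omega> \<in> space M. L \<omega> \<le> x}"
    using \<sigma> by (simp add: divide_le_cancel)
  finally show ?thesis by simp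
qed

lemma cdf_normal:
  assumes "\<sigma> > 0"
  shows "cdf (density lborel (normal_density \<mu> \<sigma>)) x = cdf std_normal_distribution ((x - \<mu>) / \<sigma>)"
proof -
  interpret N: prob_space "density lborel (normal_density \<mu> \<sigma>)"
    using assms by (rule prob_space_normal_density)
  have "distributed (density lborel (normal_density \<mu> \<sigma>)) lborel (\<lambda>x. x) (normal_density \<mu> \<sigma>)"
    unfolding distributed_def by (auto intro!: distr_id2)
  from N.normal_distributed_cdf[OF assms this, of x] show ?thesis
    by (simp add: cdf_def atMost_def)
qed

lemma isCont_cdf_std_normal: "isCont (cdf std_normal_distribution) x"
proof -
  interpret real_distribution std_normal_distribution by (rule real_dist_normal_dist)
  have "AE y in lborel. y \<in> {x} \<longrightarrow> ennreal (std_normal_density y) = 0"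
    by (rule AE_mp[OF AE_lborel_singleton[of x]]) simp
  then have "{x} \<in> null_sets std_normal_distribution"
    by (subst null_sets_density_iff) simp_all
  then show ?thesis by (simp add: isCont_cdf measure_eq_0_null_sets)
qed

text \<open>Slutsky's argument on distribution functions: up to an event of vanishing probability,
  {U <= x} contains {L <= x - \<alpha> - \<epsilon>} and is contained in {L <= x - \<alpha> +
  \<epsilon>}.\<close>

lemma (in prob_space) weak_conv_perturbed_gaussian:
  fixes L U :: "nat \<Rightarrow> 'a \<Rightarrow> real"
  assumes L: "\<And>n. centered_gaussian M (L n)"
    and var: "(\<lambda>n. expectation (\<lambda>\<omega>. (L n \<omega>)\<^sup>2)) \<longlonglongrightarrow> v" and v: "v > 0"
    and U[measurable]: "\<And>n. U n \<in> borel_measurable M"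
    and small: "\<And>\<epsilon>. \<epsilon> > 0 \<Longrightarrow> (\<lambda>n. prob {\<omega> \<in> space M. \<bar>U n \<omega> - L n \<omega> - \<alpha>\<bar> > \<epsilon>}) \<longlonglongrightarrow> 0"
  shows "weak_conv_m (\<lambda>n. distr M borel (U n)) (density lborel (normal_density \<alpha> (sqrt v)))"
proof -
  let ?\<Phi> = "cdf std_normal_distribution"
  let ?\<tau> = "\<lambda>n. sqrt (expectation (\<lambda>\<omega>. (L n \<omega>)\<^sup>2))"
  define P where "P \<epsilon> n = prob {\<omega> \<in> space M. \<bar>U n \<omega> - L n \<omega> - \<alpha>\<bar> > \<epsilon>}" for \<epsilon> n
  have Lm[measurable]: "L n \<in> borel_measurable M" for n using L by (simp add: centered_gaussian_def)
  \<comment> \<open>Positivity of \<open>v\<close> rules out the degenerate law for large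
    \<open>n\<close>.\<close>
  have cdfL: "\<forall>\<^sub>F n in sequentially. ?\<Phi> (y / ?\<tau> n) = prob {\<omega> \<in> space M. L n \<omega> \<le> y}" for y
    using order_tendstoD(1)[OF var v]
  proof eventually_elim
    case (elim n)
    have "\<not> (AE \<omega> in M. L n \<omega> = 0)"
    proof
      assume "AE \<omega> in M. L n \<omega> = 0"
      then have "expectation (\<lambda>\<omega>. (L n \<omega>)\<^sup>2) = 0" by (intro integral_eq_zero_AE) auto
      with elim show False by simp
    qed
    then obtain \<sigma> where \<sigma>: "\<sigma> > 0" "distributed M lborel (L n) (normal_density 0 \<sigma>)"
      using L[of n] by (auto simp: centered_gaussian_def)
    have "expectation (\<lambda>\<omega>. (L n \<omega>)\<^sup>2) = \<sigma>\<^sup>2"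
      using normal_distributed_variance[OF \<sigma>] normal_distributed_expectation[OF \<sigma>] by simp
    then show ?case using normal_distributed_cdf[OF \<sigma>, of y] \<sigma> by simp
  qed
  have lim: "(\<lambda>n. prob {\<omega> \<in> space M. L n \<omega> \<le> y}) \<longlonglongrightarrow> ?\<Phi> (y / sqrt v)" for y
  proof (rule Lim_transform_eventually[OF _ cdfL])
    show "(\<lambda>n. ?\<Phi> (y / ?\<tau> n)) \<longlonglongrightarrow> ?\<Phi> (y / sqrt v)"
      using v by (intro isCont_tendsto_compose[OF isCont_cdf_std_normal] tendsto_intros var) auto
  qed
  have upper: "cdf (distr M borel (U n)) x \<le> prob {\<omega> \<in> space M. L n \<omega> \<le> x - \<alpha> + \<epsilon>} + P \<epsilon> n"
    and lower: "prob {\<omega> \<in> space M. L n \<omega> \<le> x - \<alpha> - \<epsilon>} - P \<epsilon> n \<le> cdf (distr M borel (U n)) x" for x \<epsilon> n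
  proof -
    have F: "cdf (distr M borel (U n)) x = prob {\<omega> \<in> space M. U n \<omega> \<le> x}"
      unfolding cdf_def by (subst measure_distr) (auto intro!: arg_cong[where f = prob])
    have "prob {\<omega> \<in> space M. U n \<omega> \<le> x} \<le> prob ({\<omega> \<in> space M. L n \<omega> \<le> x - \<alpha> + \<epsilon>} \<union> {\<omega> \<in> space M. \<bar>U n \<omega> - L n \<omega> - \<alpha>\<bar> > \<epsilon>})"
      by (intro finite_measure_mono) auto
    also have "\<dots> \<le> prob {\<omega> \<in> space M. L n \<omega> \<le> x - \<alpha> + \<epsilon>} + P \<epsilon> n"
      unfolding P_def by (intro measure_Un_le) auto
    finally show "cdf (distr M borel (U n)) x \<le> prob {\<omega> \<in> space M. L n \<omega> \<le> x - \<alpha> + \<epsilon>} + P \<epsilon> n" using F by simp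
    have "prob {\<omega> \<in> space M. L n \<omega> \<le> x - \<alpha> - \<epsilon>} \<le> prob ({\<omega> \<in> space M. U n \<omega> \<le> x} \<union> {\<omega> \<in> space M. \<bar>U n \<omega> - L n \<omega> - \<alpha>\<bar> > \<epsilon>})"
      by (intro finite_measure_mono) auto
    also have "\<dots> \<le> prob {\<omega> \<in> space M. U n \<omega> \<le> x} + P \<epsilon> n"
      unfolding P_def by (intro measure_Un_le) auto
    finally show "prob {\<omega> \<in> space M. L n \<omega> \<le> x - \<alpha> - \<epsilon>} - P \<epsilon> n \<le> cdf (distr M borel (U n)) x" using F by simp
  qed
  have P0: "P \<epsilon> \<longlonglongrightarrow> 0" if "\<epsilon> > 0" for \<epsilon>
    using small[OF that] by (simp add: P_def[abs_def])
  have "(\<lambda>n. cdf (distr M borel (U n)) x) \<longlonglongrightarrow> cdf (density lborel (normal_density \<alpha> (sqrt v))) x" for x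
  proof (rule order_tendstoI)
    fix a assume "a < cdf (density lborel (normal_density \<alpha> (sqrt v))) x"
    then have a: "a < ?\<Phi> ((x - \<alpha> - 0) / sqrt v)" using v by (simp add: cdf_normal[of "sqrt v" \<alpha>])
    \<comment> \<open>First \<epsilon> is fixed, by continuity of the limit in \<epsilon>; only then
      does \<open>n\<close> grow.\<close>
    have "((\<lambda>\<epsilon>. ?\<Phi> ((x - \<alpha> - \<epsilon>) / sqrt v)) \<longlongrightarrow> ?\<Phi> ((x - \<alpha> - 0) / sqrt v)) (at_right 0)"
      using v by (intro isCont_tendsto_compose[OF isCont_cdf_std_normal] tendsto_intros) auto
    from order_tendstoD(1)[OF this a] have "\<forall>\<^sub>F \<epsilon> in at_right 0. 0 < \<epsilon> \<and> a < ?\<Phi> ((x - \<alpha> - \<epsilon>) / sqrt v)"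
      using eventually_at_right_less[of "0::real"] by eventually_elim simp
    then obtain \<epsilon> where \<epsilon>: "\<epsilon> > 0" "a < ?\<Phi> ((x - \<alpha> - \<epsilon>) / sqrt v)"
      using eventually_happens'[OF trivial_limit_at_right_real] by blast
    have "(\<lambda>n. prob {\<omega> \<in> space M. L n \<omega> \<le> x - \<alpha> - \<epsilon>} - P \<epsilon> n) \<longlonglongrightarrow> ?\<Phi> ((x - \<alpha> - \<epsilon>) / sqrt v) - 0"
      by (intro tendsto_diff lim P0 \<epsilon>)
    with \<epsilon>(2) have "\<forall>\<^sub>F n in sequentially. a < prob {\<omega> \<in> space M. L n \<omega> \<le> x - \<alpha> - \<epsilon>} - P \<epsilon> n"
      by (intro order_tendstoD) auto
    then show "\<forall>\<^sub>F n in sequentially. a < cdf (distr M borel (U n)) x"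
      by eventually_elim (rule order_less_le_trans[OF _ lower])
  next
    fix a assume "cdf (density lborel (normal_density \<alpha> (sqrt v))) x < a"
    then have a: "?\<Phi> ((x - \<alpha> + 0) / sqrt v) < a" using v by (simp add: cdf_normal[of "sqrt v" \<alpha>])
    have "((\<lambda>\<epsilon>. ?\<Phi> ((x - \<alpha> + \<epsilon>) / sqrt v)) \<longlongrightarrow> ?\<Phi> ((x - \<alpha> + 0) / sqrt v)) (at_right 0)"
      using v by (intro isCont_tendsto_compose[OF isCont_cdf_std_normal] tendsto_intros) auto
    from order_tendstoD(2)[OF this a] have "\<forall>\<^sub>F \<epsilon> in at_right 0. 0 < \<epsilon> \<and> ?\<Phi> ((x - \<alpha> + \<epsilon>) / sqrt v) < a"
      using eventually_at_right_less[of "0::real"] by eventually_elim simp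
    then obtain \<epsilon> where \<epsilon>: "\<epsilon> > 0" "?\<Phi> ((x - \<alpha> + \<epsilon>) / sqrt v) < a"
      using eventually_happens'[OF trivial_limit_at_right_real] by blast
    have "(\<lambda>n. prob {\<omega> \<in> space M. L n \<omega> \<le> x - \<alpha> + \<epsilon>} + P \<epsilon> n) \<longlonglongrightarrow> ?\<Phi> ((x - \<alpha> + \<epsilon>) / sqrt v) + 0"
      by (intro tendsto_add lim P0 \<epsilon>)
    with \<epsilon>(2) have "\<forall>\<^sub>F n in sequentially. prob {\<omega> \<in> space M. L n \<omega> \<le> x - \<alpha> + \<epsilon>} + P \<epsilon> n < a"
      by (intro order_tendstoD) auto
    then show "\<forall>\<^sub>F n in sequentially. cdf (distr M borel (U n)) x < a"
      by eventually_elim (rule order_le_less_trans[OF upper])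
  qed
  then show ?thesis by (simp add: weak_conv_m_def weak_conv_def)
qed

section \<open>Eigenvalue error in probability and limit law for the centred field\<close>

context stationary_gaussian
begin

definition T :: "nat \<Rightarrow> 'a \<Rightarrow> real" where
  "T N \<omega> = (\<Sum>i<N. \<Sum>k<N. (\<Sum>j<N. W i j \<omega> * W j k \<omega>)\<^sup>2)"

lemma measurable_W[measurable]: "W i j \<in> borel_measurable M"
  by (intro G_measurable W_in_G)

lemma measurable_S[measurable]: "S N \<in> borel_measurable M"
  by (intro G_measurable S_in_G)

lemma measurable_Y[measurable]: "Y N \<in> borel_measurable M"
  unfolding Y_def[abs_def] V_def by measurable

lemma measurable_T[measurable]: "T N \<in> borel_measurable M"
  unfolding T_def[abs_def] by measurable

lemma prob_ge_le_expectation: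
  assumes "integrable M f" "\<And>\<omega>. f \<omega> \<ge> 0" "c > 0"
  shows "prob {\<omega> \<in> space M. f \<omega> \<ge> c} \<le> expectation f / c"
  using integral_Markov_inequality_measure[OF assms(1), of "space M" c] assms by simp

definition top_eig :: "real \<Rightarrow> nat \<Rightarrow> 'a \<Rightarrow> real" where
  "top_eig c N \<omega> = largest_eigenvalue (mat N N (\<lambda>(i, j). c + W i j \<omega>))"

lemma measurable_top_eig: "N > 0 \<Longrightarrow> top_eig c N \<in> borel_measurable M"
  unfolding top_eig_def[abs_def] by (intro measurable_largest_eigenvalue) (auto simp: W_sym)

text \<open>The deterministic bounds at a single outcome, where the bound on \<open>T\<close>
  supplies the operator-norm bound \<rho> = \<delta> N.\<close>

lemma top_eig_error_small:
  assumes \<delta>: "\<delta> > 0" "2 * \<delta> < c" and N\<delta>: "N > 0" "1 / real N \<le> \<delta>"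
    and S: "(S N \<omega>)\<^sup>2 \<le> \<delta>\<^sup>2 * N" and Y: "\<bar>Y N \<omega> - \<kappa>\<bar> \<le> \<delta>" and T: "T N \<omega> \<le> (\<delta> * N) ^ 4"
  shows "top_eig c N \<omega> - c * N - S N \<omega> - \<kappa> / c \<le> (\<kappa> + \<delta>) / (c - 2 * \<delta>) - \<kappa> / c"
    and "top_eig c N \<omega> - c * N - S N \<omega> - \<kappa> / c \<ge>
      - ((\<delta> + \<delta>\<^sup>2) / c + 2 * \<delta> * (\<kappa> + \<delta>) / c\<^sup>2 + \<delta> * (\<kappa> + \<delta>)\<^sup>2 / c ^ 3)"
proof -
  interpret r: rank_one_perturbation "\<lambda>i j. W i j \<omega>" N c "\<delta> * N"
  proof
    show "\<bar>quad_form N (\<lambda>i j. W i j \<omega>) y\<bar> \<le> \<delta> * N * (\<Sum>i<N. (y i)\<^sup>2)" for y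
      using \<delta> T by (intro quad_form_le_fourth_root) (auto simp: W_sym T_def)
  qed (use \<delta> N\<delta> in \<open>auto simp: W_sym\<close>)
  have V: "r.rowsum = (\<lambda>i. V N i \<omega>)" by (simp add: r.rowsum_def V_def fun_eq_iff)
  have s: "r.s = S N \<omega>" by (simp add: r.s_def V S_eq_sum_V)
  have t: "r.top_eig = top_eig c N \<omega>" by (simp add: r.top_eig_def top_eig_def)
  have "(r.s)\<^sup>2 \<le> \<delta>\<^sup>2 * N" using S s by simp
  moreover have "\<bar>(\<Sum>i<N. (r.rowsum i)\<^sup>2) / (real N)\<^sup>2 - \<kappa>\<bar> \<le> \<delta>"
    using Y by (simp add: V Y_def)
  ultimately show "top_eig c N \<omega> - c * N - S N \<omega> - \<kappa> / c \<le> (\<kappa> + \<delta>) / (c - 2 * \<delta>) - \<kappa> / c"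
    "top_eig c N \<omega> - c * N - S N \<omega> - \<kappa> / c \<ge>
      - ((\<delta> + \<delta>\<^sup>2) / c + 2 * \<delta> * (\<kappa> + \<delta>) / c\<^sup>2 + \<delta> * (\<kappa> + \<delta>)\<^sup>2 / c ^ 3)"
    using r.top_eig_error[of \<delta> \<kappa>, OF \<delta> N\<delta>(2) refl] by (simp_all add: s t r.m_def)
qed

lemma top_eig_error_tendsto:
  assumes c: "c > 0" and \<epsilon>: "\<epsilon> > 0"
  shows "(\<lambda>N. prob {\<omega> \<in> space M. \<bar>top_eig c N \<omega> - c * N - S N \<omega> - \<kappa> / c\<bar> > \<epsilon>}) \<longlonglongrightarrow> 0"
proof -
  obtain \<delta> where \<delta>: "\<delta> > 0" "2 * \<delta> < c" "(\<kappa> + \<delta>) / (c - 2 * \<delta>) - \<kappa> / c < \<epsilon>"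
    "(\<delta> + \<delta>\<^sup>2) / c + 2 * \<delta> * (\<kappa> + \<delta>) / c\<^sup>2 + \<delta> * (\<kappa> + \<delta>)\<^sup>2 / c ^ 3 < \<epsilon>"
    using perturbation_error_small[OF c \<epsilon>] by metis
  define e where "e N = (\<Sum>i<N. C (V N i) (V N i)) / (real N)\<^sup>2" for N
  \<comment> \<open>The sum of the Markov bounds for the three bad events below, with 1 / N kept as
    a separate factor for the limit.\<close>
  define b where "b N = C (S N) (S N) / \<delta>\<^sup>2 * (1 / real N) + ((e N - \<kappa>)\<^sup>2 + 32 * B\<^sup>2 * (1 / real N)) / \<delta>\<^sup>2
    + 48 * B\<^sup>2 / \<delta> ^ 4 * (1 / real N)" for N
  have "b \<longlonglongrightarrow> 4 * (\<Sum>\<^sub>\<infinity>(i, j). R i j) / \<delta>\<^sup>2 * 0 + ((\<kappa> - \<kappa>)\<^sup>2 + 32 * B\<^sup>2 * 0) / \<delta>\<^sup>2 + 48 * B\<^sup>2 / \<delta> ^ 4 * 0"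
    unfolding b_def[abs_def] e_def using \<delta>(1)
    by (intro tendsto_intros C_S_tendsto lim_1_over_n mean_Y_tendsto) auto
  then have b0: "b \<longlonglongrightarrow> 0" by simp
  show ?thesis
  proof (rule Lim_null_comparison[OF _ b0])
    have "\<forall>\<^sub>F N in sequentially. 1 / real N < \<delta>"
      using order_tendstoD(2)[OF lim_1_over_n \<delta>(1)] .
    then show "\<forall>\<^sub>F N in sequentially.
        norm (prob {\<omega> \<in> space M. \<bar>top_eig c N \<omega> - c * N - S N \<omega> - \<kappa> / c\<bar> > \<epsilon>}) \<le> b N"
      using eventually_gt_at_top[of 0]
    proof eventually_elim
      case (elim N)
      let ?E1 = "{\<omega> \<in> space M. (S N \<omega>)\<^sup>2 \<ge> \<delta>\<^sup>2 * N}"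
      let ?E2 = "{\<omega> \<in> space M. (Y N \<omega> - \<kappa>)\<^sup>2 \<ge> \<delta>\<^sup>2}"
      let ?E3 = "{\<omega> \<in> space M. T N \<omega> \<ge> (\<delta> * N) ^ 4}"
      have N: "real N > 0" using elim by simp
      have "{\<omega> \<in> space M. \<bar>top_eig c N \<omega> - c * N - S N \<omega> - \<kappa> / c\<bar> > \<epsilon>} \<subseteq> ?E1 \<union> ?E2 \<union> ?E3"
      proof (rule subsetI, rule ccontr)
        fix \<omega> assume \<omega>: "\<omega> \<in> {\<omega> \<in> space M. \<bar>top_eig c N \<omega> - c * N - S N \<omega> - \<kappa> / c\<bar> > \<epsilon>}"
          and "\<omega> \<notin> ?E1 \<union> ?E2 \<union> ?E3"
        then have small: "(S N \<omega>)\<^sup>2 \<le> \<delta>\<^sup>2 * N" "(Y N \<omega> - \<kappa>)\<^sup>2 \<le> \<delta>\<^sup>2" "T N \<omega> \<le> (\<delta> * N) ^ 4"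
          by (simp_all only: Un_iff mem_Collect_eq de_Morgan_disj de_Morgan_conj not_le not_True_eq_False
              simp_thms less_imp_le)
        have "\<bar>Y N \<omega> - \<kappa>\<bar> \<le> \<bar>\<delta>\<bar>"
          using small(2) by (simp only: abs_le_square_iff)
        then have "\<bar>Y N \<omega> - \<kappa>\<bar> \<le> \<delta>" using \<delta>(1) by simp
        from top_eig_error_small[OF \<delta>(1,2) _ _ small(1) this small(3)] elim
        have "top_eig c N \<omega> - c * N - S N \<omega> - \<kappa> / c \<le> (\<kappa> + \<delta>) / (c - 2 * \<delta>) - \<kappa> / c"
          "top_eig c N \<omega> - c * N - S N \<omega> - \<kappa> / c \<ge>
            - ((\<delta> + \<delta>\<^sup>2) / c + 2 * \<delta> * (\<kappa> + \<delta>) / c\<^sup>2 + \<delta> * (\<kappa> + \<delta>)\<^sup>2 / c ^ 3)"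
          by (simp_all only: less_imp_le)
        with \<omega> \<delta>(3,4) show False by (simp only: mem_Collect_eq) linarith
      qed
      then have "prob {\<omega> \<in> space M. \<bar>top_eig c N \<omega> - c * N - S N \<omega> - \<kappa> / c\<bar> > \<epsilon>} \<le> prob (?E1 \<union> ?E2 \<union> ?E3)"
        by (intro finite_measure_mono) auto
      also have "\<dots> \<le> prob ?E1 + prob ?E2 + prob ?E3"
        by (intro order_trans[OF measure_Un_le] add_mono measure_Un_le order_refl) measurable
      also have "\<dots> \<le> C (S N) (S N) / \<delta>\<^sup>2 * (1 / real N) + ((e N - \<kappa>)\<^sup>2 + 32 * B\<^sup>2 * (1 / real N)) / \<delta>\<^sup>2
          + 48 * B\<^sup>2 / \<delta> ^ 4 * (1 / real N)"
      proof (intro add_mono)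
        show "prob ?E1 \<le> C (S N) (S N) / \<delta>\<^sup>2 * (1 / real N)"
          using prob_ge_le_expectation[of "\<lambda>\<omega>. (S N \<omega>)\<^sup>2" "\<delta>\<^sup>2 * N"] \<delta>(1) N
            centered_gaussian_moments(1)[OF G_gaussian[OF S_in_G]] by (simp add: C_self)
        have "prob ?E2 \<le> expectation (\<lambda>\<omega>. (Y N \<omega> - \<kappa>)\<^sup>2) / \<delta>\<^sup>2"
          using \<delta>(1) elim by (intro prob_ge_le_expectation Y_second_moment) auto
        also have "\<dots> \<le> ((e N - \<kappa>)\<^sup>2 + 32 * B\<^sup>2 * (1 / real N)) / \<delta>\<^sup>2"
          using Y_second_moment(2)[of N \<kappa>] elim by (intro divide_right_mono) (auto simp: e_def)
        finally show "prob ?E2 \<le> ((e N - \<kappa>)\<^sup>2 + 32 * B\<^sup>2 * (1 / real N)) / \<delta>\<^sup>2" .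
        have "prob ?E3 \<le> expectation (T N) / (\<delta> * N) ^ 4"
          using \<delta>(1) N expectation_trace4(1)[of N]
          by (intro prob_ge_le_expectation) (auto simp: T_def[abs_def] intro!: sum_nonneg)
        also have "\<dots> \<le> 48 * B\<^sup>2 * real N ^ 3 / (\<delta> * N) ^ 4"
          using expectation_trace4(2)[of N] by (intro divide_right_mono) (auto simp: T_def[abs_def])
        also have "\<dots> = 48 * B\<^sup>2 / \<delta> ^ 4 * (1 / real N)"
          using N by (simp add: power_mult_distrib power3_eq_cube power4_eq_xxxx)
        finally show "prob ?E3 \<le> 48 * B\<^sup>2 / \<delta> ^ 4 * (1 / real N)" .
      qed
      finally show ?case by (simp add: b_def)
    qed
  qed
qed

text \<open>Four times the sum is a limit of variances. With this, a nonzero sum is a positive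
  limiting variance.\<close>

lemma sum_R_nonneg: "(\<Sum>\<^sub>\<infinity>(i, j). R i j) \<ge> 0"
proof -
  have "4 * (\<Sum>\<^sub>\<infinity>(i, j). R i j) \<ge> 0"
    by (rule tendsto_lowerbound[OF C_S_tendsto]) (auto simp: C_self)
  then show ?thesis by simp
qed

text \<open>\<open>Suc n\<close> avoids the empty matrix, whose largest eigenvalue would be
  \<open>Max\<close> of the empty set.\<close>

theorem top_eig_weak_conv:
  assumes c: "c > 0" and R0: "(\<Sum>\<^sub>\<infinity>(i, j). R i j) \<noteq> 0"
  shows "weak_conv_m (\<lambda>n. distr M borel (\<lambda>\<omega>. top_eig c (Suc n) \<omega> - c * real (Suc n)))
    (density lborel (normal_density (\<kappa> / c) (sqrt (4 * (\<Sum>\<^sub>\<infinity>(i, j). R i j)))))"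
proof (rule weak_conv_perturbed_gaussian[where L = "\<lambda>n. S (Suc n)"])
  show "centered_gaussian M (S (Suc n))" for n by (intro G_gaussian S_in_G)
  show "(\<lambda>n. expectation (\<lambda>\<omega>. (S (Suc n) \<omega>)\<^sup>2)) \<longlonglongrightarrow> 4 * (\<Sum>\<^sub>\<infinity>(i, j). R i j)"
    using LIMSEQ_Suc[OF C_S_tendsto] by (simp add: C_self)
  show "4 * (\<Sum>\<^sub>\<infinity>(i, j). R i j) > 0" using sum_R_nonneg R0 by simp
  show "(\<lambda>\<omega>. top_eig c (Suc n) \<omega> - c * real (Suc n)) \<in> borel_measurable M" for n
    using measurable_top_eig[of "Suc n" c] by simp
  show "(\<lambda>n. prob {\<omega> \<in> space M. \<bar>top_eig c (Suc n) \<omega> - c * real (Suc n) - S (Suc n) \<omega> - \<kappa> / c\<bar> > \<epsilon>}) \<longlonglongrightarrow> 0"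
    if "\<epsilon> > 0" for \<epsilon>
    using LIMSEQ_Suc[OF top_eig_error_tendsto[OF c that]] .
qed

end

section \<open>Passage from the process to the centred field\<close>

lemma stationary_gaussianI:
  fixes M :: "'a measure" and Z :: "int \<Rightarrow> int \<Rightarrow> 'a \<Rightarrow> real"
  assumes M: "prob_space M"
    and gauss: "gaussian_process_Z2 M Z"
    and stat: "stationary_Z2 M Z"
    and mean: "\<And>i j. integral\<^sup>L M (Z i j) = \<theta>"
    and R: "\<And>i j. R i j = covariance M (Z 0 0) (Z i j)"
    and summ: "(\<lambda>(i, j). \<bar>R i j\<bar>) summable_on UNIV"
  shows "stationary_gaussian M (\<lambda>p \<omega>. Z (fst p) (snd p) \<omega> - \<theta>) R"
proof -
  interpret prob_space M by fact
  have Zg: "gaussian_rv M (Z i j)" for i j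
    using gauss[unfolded gaussian_process_Z2_def, rule_format, of "{(i, j)}" "\<lambda>_. 1"] by simp
  have Zm[measurable]: "Z i j \<in> borel_measurable M" for i j using Zg by (simp add: gaussian_rv_def)
  have Zi: "integrable M (Z i j)" for i j by (intro gaussian_rv_integrable Zg)
  interpret gaussian_family M "\<lambda>p \<omega>. Z (fst p) (snd p) \<omega> - \<theta>"
  proof
    fix F :: "(int \<times> int) set" and c assume F: "finite F"
    let ?L = "\<lambda>\<omega>. \<Sum>p\<in>F. c p * Z (fst p) (snd p) \<omega>"
    have "centered_gaussian M (\<lambda>\<omega>. ?L \<omega> - expectation ?L)"
      using F gauss by (intro gaussian_rv_centered) (auto simp: gaussian_process_Z2_def)
    moreover have "expectation ?L = (\<Sum>p\<in>F. c p * \<theta>)"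
      by (simp add: Zi mean)
    ultimately show "centered_gaussian M (\<lambda>\<omega>. \<Sum>p\<in>F. c p * (Z (fst p) (snd p) \<omega> - \<theta>))"
      by (simp add: right_diff_distrib sum_subtractf)
  qed
  show ?thesis
  proof
    fix i j k l
    let ?P = "Pi\<^sub>M UNIV (\<lambda>_. borel) :: (int \<times> int \<Rightarrow> real) measure"
    \<comment> \<open>A functional of the whole path: under the law shifted by (i, j) its mean is
      the covariance at (i, j) and (k, l), under the unshifted law it is
      \<open>R (k - i) (l - j)\<close>.\<close>
    let ?f = "\<lambda>z :: int \<times> int \<Rightarrow> real. (z (0, 0) - \<theta>) * (z (k - i, l - j) - \<theta>)"
    have f[measurable]: "?f \<in> borel_measurable ?P" by measurable
    have m: "(\<lambda>\<omega> p. Z (fst p + a) (snd p + b) \<omega>) \<in> measurable M ?P" for a b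
      by (intro measurable_PiM_single') auto
    have law: "integral\<^sup>L (process_law M (\<lambda>i' j'. Z (i' + a) (j' + b))) ?f
        = expectation (\<lambda>\<omega>. (Z a b \<omega> - \<theta>) * (Z (k - i + a) (l - j + b) \<omega> - \<theta>))" for a b
      unfolding process_law_def by (subst integral_distr[OF m f]) simp
    have "C (\<lambda>\<omega>. Z (fst (i, j)) (snd (i, j)) \<omega> - \<theta>) (\<lambda>\<omega>. Z (fst (k, l)) (snd (k, l)) \<omega> - \<theta>)
        = integral\<^sup>L (process_law M (\<lambda>i' j'. Z (i' + i) (j' + j))) ?f"
      by (simp add: C_def law)
    \<comment> \<open>The zero shift is written out so that \<open>law\<close> also applies to the
      unshifted process.\<close>
    also have "\<dots> = integral\<^sup>L (process_law M (\<lambda>i' j'. Z (i' + 0) (j' + 0))) ?f"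
      using stat unfolding stationary_Z2_def by simp
    also have "\<dots> = R (k - i) (l - j)"
      unfolding law by (simp add: R covariance_def mean)
    finally show "C (\<lambda>\<omega>. Z (fst (i, j)) (snd (i, j)) \<omega> - \<theta>) (\<lambda>\<omega>. Z (fst (k, l)) (snd (k, l)) \<omega> - \<theta>)
      = R (k - i) (l - j)" .
  qed (fact summ)
qed

theorem theorem1:
  fixes M :: "'a measure" and Z :: "int \<Rightarrow> int \<Rightarrow> 'a \<Rightarrow> real"
    and \<theta> :: real and R :: "int \<Rightarrow> int \<Rightarrow> real"
  assumes "prob_space M"
    and "\<theta> > 0"
    and "gaussian_process_Z2 M Z"
    and "stationary_Z2 M Z"
    and "\<And>i j. integral\<^sup>L M (Z i j) = \<theta>"
    and "\<And>i j. R i j = covariance M (Z 0 0) (Z i j)"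
    and "(\<lambda>(i, j). \<bar>R i j\<bar>) summable_on UNIV"
    and "(\<Sum>\<^sub>\<infinity>(i, j)\<in>UNIV. R i j) \<noteq> 0"
  shows "weak_conv_m
           (\<lambda>n. distr M borel
                  (\<lambda>\<omega>. largest_eigenvalue (A_mat Z (Suc n) \<omega>) - 2 * real (Suc n) * \<theta>))
           (density lborel
              (normal_density ((1 / (2 * \<theta>)) * (\<Sum>\<^sub>\<infinity>i\<in>UNIV. R i 0 + R 0 i))
                              (sqrt (4 * (\<Sum>\<^sub>\<infinity>(i, j)\<in>UNIV. R i j)))))"
proof -
  interpret stationary_gaussian M "\<lambda>p \<omega>. Z (fst p) (snd p) \<omega> - \<theta>" R
    using assms(1,3-7) by (rule stationary_gaussianI)
  have "largest_eigenvalue (A_mat Z N \<omega>) - 2 * real N * \<theta> = top_eig (2 * \<theta>) N \<omega> - 2 * \<theta> * real N" for N \<omega>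
  proof -
    \<comment> \<open>Each entry is a sum of two field values, so centring removes \<theta> twice:
      this is the coefficient 2 \<theta> of the rank-one part.\<close>
    have "A_mat Z N \<omega> = mat N N (\<lambda>(i, j). 2 * \<theta> + W i j \<omega>)"
      by (rule eq_matI) (simp_all add: A_mat_def W_def)
    then show ?thesis by (simp add: top_eig_def)
  qed
  moreover have "1 / (2 * \<theta>) * (\<Sum>\<^sub>\<infinity>i. R i 0 + R 0 i) = \<kappa> / (2 * \<theta>)"
    by (simp add: \<kappa>_def)
  ultimately show ?thesis
    using top_eig_weak_conv[of "2 * \<theta>"] assms(2,8) by (simp only:) simp
qed

end
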